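(* Let $a$ and $b$ be coprime positive integers. The Frobenius characteristic of the permutation $S_a$-module $\mathsf{PF}_{a,b}$ of $(a,b)$-parking functions has the following expansions in terms of complete homogeneous, power sum, and Schur symmetric functions, respectively: $$\mathsf{Frob}(\mathsf{PF}_{a,b})=\sum_{\lambda\vdash a}\frac{1}{b}\binom{b}{b-\ell(\lambda),m_1(\lambda),m_2(\lambda),\ldots,m_a(\lambda)}h_\lambda(\mathbf{x}) =\sum_{\lambda\vdash a} b^{\ell(\lambda)-1}\frac{p_\lambda(\mathbf{x})}{z_\lambda} =\sum_{\lambda\vdash a}\frac{s_\lambda(1^b)}{b}\,s_\lambda(\mathbf{x}).$$
   Context: An $(a,b)$-Dyck path is a lattice path from $(0,0)$ to $(b,a)$ consisting of $a$ unit north steps and $b$ unit east steps that stays weakly above the line $y=\frac{a}{b}x$. An $(a,b)$-parking function is an $(a,b)$-Dyck path together with a bijective labeling of its $a$ north steps by $\{1,2,\ldots,a\}$ such that the labels increase going north within each column (i.e. among north steps with the same $x$-coordinate). The symmetric group $S_a$ acts on the set of $(a,b)$-parking functions by permuting the labels and then re-sorting the labels within each column into increasing order. $\mathsf{PF}_{a,b}$ denotes both this set and the corresponding permutation $S_a$-module over $\mathbb{C}$. The Frobenius characteristic of an $S_a$-module with character $\chi$ is $\sum_{\mu\vdash a}\chi(\mu)\,p_\mu(\mathbf{x})/z_\mu$, where $\chi(\mu)$ is the value of $\chi$ on permutations of cycle type $\mu$. For a partition $\lambda$: $\ell(\lambda)$ is the number of (positive) parts, $m_j(\lambda)$ is the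 number of parts equal to $j$, and $z_\lambda=\prod_{j\ge1}j^{m_j(\lambda)}m_j(\lambda)!$. The symmetric functions $h_\lambda,p_\lambda,s_\lambda$ are the usual complete homogeneous, power sum, and Schur symmetric functions in $\mathbf{x}=(x_1,x_2,\ldots)$. $s_\lambda(1^b)$ is $s_\lambda$ evaluated with $b$ variables set to $1$ and the rest to $0$. The multinomial coefficient $\binom{b}{k_0,\ldots,k_a}$ equals $\frac{b!}{k_0!\cdots k_a!}$ and is $0$ if some $k_i$ is negative. *)

theory Defs
  imports
    Complex_Main
    "HOL-Library.Multiset"
    "HOL-Library.FuncSet"
    "HOL-Library.Poly_Mapping"
    "HOL-Library.Groups_Big_Fun"
    "HOL-Combinatorics.Permutations"
    "HOL-Combinatorics.Orbits"
begin

section \<open>Formal series in countably many variables\<close>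

text \<open>
  Symmetric functions live in the ring of formal series in \<open>x\<^sub>0, x\<^sub>1, \<dots>\<close> (the variables are
  numbered from 0). A monomial is a finite multiset of variable indices, the multiset
  \<open>{#i, i, j#}\<close> standing for \<open>x\<^sub>i\<^sup>2 x\<^sub>j\<close>, so that multiset union is multiplication of monomials.
\<close>

typedef 'a mseries = "UNIV :: (nat multiset \<Rightarrow> 'a) set"
  morphisms coeff Abs_mseries by simp

lemma coeff_Abs [simp]: "coeff (Abs_mseries f) = f"
  by (simp add: Abs_mseries_inverse)

lemma mseries_eqI: "(\<And>m. coeff f m = coeff g m) \<Longrightarrow> f = g"
  by (metis coeff_inject ext)

definition splits :: "nat multiset \<Rightarrow> (nat multiset \<times> nat multiset) set" where
  "splits m = {(u, v). u + v = m}"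

instantiation mseries :: (comm_ring_1) comm_ring_1
begin

definition zero_mseries :: "'a mseries" where
  "0 = Abs_mseries (\<lambda>m. 0)"
definition one_mseries :: "'a mseries" where
  "1 = Abs_mseries (\<lambda>m. if m = {#} then 1 else 0)"
definition plus_mseries :: "'a mseries \<Rightarrow> 'a mseries \<Rightarrow> 'a mseries" where
  "f + g = Abs_mseries (\<lambda>m. coeff f m + coeff g m)"
definition uminus_mseries :: "'a mseries \<Rightarrow> 'a mseries" where
  "- f = Abs_mseries (\<lambda>m. - coeff f m)"
definition minus_mseries :: "'a mseries \<Rightarrow> 'a mseries \<Rightarrow> 'a mseries" where
  "f - g = Abs_mseries (\<lambda>m. coeff f m - coeff g m)"
definition times_mseries :: "'a mseries \<Rightarrow> 'a mseries \<Rightarrow> 'a mseries" where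
  "f * g = Abs_mseries (\<lambda>m. \<Sum>(u, v)\<in>splits m. coeff f u * coeff g v)"

lemma finite_splits: "finite (splits m)"
proof -
  have "splits m \<subseteq> {u. u \<subseteq># m} \<times> {u. u \<subseteq># m}"
    by (auto simp: splits_def)
  moreover have "{u. u \<subseteq># m} \<subseteq> mset ` {xs. set xs \<subseteq> set_mset m \<and> length xs \<le> size m}"
  proof
    fix u assume u: "u \<in> {u. u \<subseteq># m}"
    obtain xs where xs: "mset xs = u" using ex_mset by blast
    have "set xs \<subseteq> set_mset m" "length xs \<le> size m"
      using u xs set_mset_mono size_mset_mono[of u m] by fastforce+
    with xs show "u \<in> mset ` {xs. set xs \<subseteq> set_mset m \<and> length xs \<le> size m}" by blast
  qed
  then have "finite {u. u \<subseteq># m}"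
    by (rule finite_subset) (intro finite_imageI finite_lists_length_le, simp)
  ultimately show ?thesis by (meson finite_SigmaI finite_subset)
qed

instance
proof
  fix f g h :: "'a mseries"
  show "f + g + h = f + (g + h)"
    by (rule mseries_eqI) (simp add: plus_mseries_def add.assoc)
  show "f + g = g + f"
    by (rule mseries_eqI) (simp add: plus_mseries_def add.commute)
  show "0 + f = f" "- f + f = 0" "f - g = f + - g"
    by (auto intro!: mseries_eqI
        simp: plus_mseries_def zero_mseries_def uminus_mseries_def minus_mseries_def)
  show "f * g = g * f"
  proof (rule mseries_eqI)
    fix m
    show "coeff (f * g) m = coeff (g * f) m"
      unfolding times_mseries_def coeff_Abs
      by (rule sum.reindex_bij_witness[of _ prod.swap prod.swap])
        (auto simp: splits_def union_commute mult.commute)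
  qed
  show "f * g * h = f * (g * h)"
  proof (rule mseries_eqI)
    fix m
    have "coeff (f * g * h) m
        = (\<Sum>p\<in>splits m. \<Sum>q\<in>splits (fst p). coeff f (fst q) * coeff g (snd q) * coeff h (snd p))"
      unfolding times_mseries_def coeff_Abs case_prod_beta sum_distrib_right ..
    also have "\<dots> = (\<Sum>(p, q)\<in>Sigma (splits m) (\<lambda>p. splits (fst p)).
        coeff f (fst q) * coeff g (snd q) * coeff h (snd p))"
      by (rule sum.Sigma) (simp_all add: finite_splits)
    also have "\<dots> = (\<Sum>(p, q)\<in>Sigma (splits m) (\<lambda>p. splits (snd p)).
        coeff f (fst p) * (coeff g (fst q) * coeff h (snd q)))"
      by (rule sum.reindex_bij_witness[of _
            "\<lambda>(p, q). ((fst p + fst q, snd q), (fst p, fst q))"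
            "\<lambda>(p, q). ((fst q, snd q + snd p), (snd q, snd p))"])
        (clarsimp simp: splits_def union_assoc mult.assoc)+
    also have "\<dots> = (\<Sum>p\<in>splits m. \<Sum>q\<in>splits (snd p).
        coeff f (fst p) * (coeff g (fst q) * coeff h (snd q)))"
      by (rule sum.Sigma[symmetric]) (simp_all add: finite_splits)
    also have "\<dots> = coeff (f * (g * h)) m"
      unfolding times_mseries_def coeff_Abs case_prod_beta sum_distrib_left ..
    finally show "coeff (f * g * h) m = coeff (f * (g * h)) m" .
  qed
  show "1 * f = f"
  proof (rule mseries_eqI)
    fix m
    have "coeff (1 * f) m = (\<Sum>(u, v)\<in>{({#}, m)}. coeff 1 u * coeff f v)"
      unfolding times_mseries_def coeff_Abs
      by (rule sum.mono_neutral_right)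
        (auto simp: finite_splits, auto simp: splits_def one_mseries_def split: if_splits)
    then show "coeff (1 * f) m = coeff f m"
      by (simp add: one_mseries_def)
  qed
  show "(f + g) * h = f * h + g * h"
    by (rule mseries_eqI)
      (simp add: times_mseries_def plus_mseries_def case_prod_beta distrib_right sum.distrib)
  have "coeff (0::'a mseries) {#} \<noteq> coeff 1 {#}"
    by (simp add: zero_mseries_def one_mseries_def)
  then show "(0::'a mseries) \<noteq> 1"
    by auto
qed

end

definition scale :: "'a::comm_ring_1 \<Rightarrow> 'a mseries \<Rightarrow> 'a mseries" where
  "scale c f = Abs_mseries (\<lambda>m. c * coeff f m)"

text \<open>
  Substitution \<open>x\<^sub>i := t i\<close>; meaningful when only finitely many monomials of \<open>f\<close> take a nonzero
  value, for instance when \<open>f\<close> has bounded degree and \<open>t\<close> has finite support.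
\<close>

definition evaluate :: "(nat \<Rightarrow> 'a::comm_ring_1) \<Rightarrow> 'a mseries \<Rightarrow> 'a" where
  "evaluate t f = Sum_any (\<lambda>m. coeff f m * (\<Prod>i\<in>#m. t i))"

definition evaluate_ones :: "nat \<Rightarrow> 'a::comm_ring_1 mseries \<Rightarrow> 'a" where
  "evaluate_ones b f = evaluate (\<lambda>i. if i < b then 1 else 0) f"


section \<open>Partitions and symmetric functions\<close>

text \<open>
  A partition is the multiset of its positive parts: \<open>\<ell>(\<mu>)\<close> is \<open>size \<mu>\<close> and \<open>m\<^sub>j(\<mu>)\<close> is
  \<open>count \<mu> j\<close>.
\<close>

definition partitions :: "nat \<Rightarrow> nat multiset set" where
  "partitions n = {\<mu>. 0 \<notin># \<mu> \<and> sum_mset \<mu> = n}"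

lemma finite_partitions: "finite (partitions n)"
proof -
  have size: "size \<mu> \<le> sum_mset \<mu>" if "0 \<notin># \<mu>" for \<mu> :: "nat multiset"
    using that by (induction \<mu>) auto
  have "partitions n \<subseteq> mset ` {xs. set xs \<subseteq> {..n} \<and> length xs \<le> n}"
  proof
    fix \<mu> assume \<mu>: "\<mu> \<in> partitions n"
    obtain xs where xs: "mset xs = \<mu>" using ex_mset by blast
    have "length xs \<le> n"
      using size[of \<mu>] \<mu> xs by (auto simp: partitions_def)
    moreover have "set xs \<subseteq> {..n}"
      using \<mu> xs by (auto simp: partitions_def sum_mset_sum_list member_le_sum_list)
    ultimately show "\<mu> \<in> mset ` {xs. set xs \<subseteq> {..n} \<and> length xs \<le> n}"
      using xs by blast
  qed
  then show ?thesis
    by (rule finite_subset) (intro finite_imageI finite_lists_length_le, simp)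
qed

definition zee :: "nat multiset \<Rightarrow> nat" where
  "zee \<mu> = (\<Prod>j\<in>set_mset \<mu>. j ^ count \<mu> j * fact (count \<mu> j))"

text \<open>Intended for lower entries with sum \<open>n\<close>.\<close>

definition multinomial :: "nat \<Rightarrow> int list \<Rightarrow> nat" where
  "multinomial n ks =
    (if \<exists>k\<in>set ks. k < 0 then 0 else fact n div (\<Prod>k\<leftarrow>ks. fact (nat k)))"

definition complete_homogeneous :: "nat \<Rightarrow> complex mseries" where
  "complete_homogeneous n = Abs_mseries (\<lambda>m. if size m = n then 1 else 0)"

definition power_sum :: "nat \<Rightarrow> complex mseries" where
  "power_sum n = Abs_mseries (\<lambda>m. if \<exists>i. m = replicate_mset n i then 1 else 0)"

definition h_fun :: "nat multiset \<Rightarrow> complex mseries" where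
  "h_fun \<mu> = (\<Prod>j\<in>#\<mu>. complete_homogeneous j)"

definition p_fun :: "nat multiset \<Rightarrow> complex mseries" where
  "p_fun \<mu> = (\<Prod>j\<in>#\<mu>. power_sum j)"

text \<open>
  Young diagrams in English notation, with cells \<open>(row, column)\<close> numbered from 0. The entries of
  a tableau are variable indices, hence also start at 0.
\<close>

definition diagram :: "nat multiset \<Rightarrow> (nat \<times> nat) set" where
  "diagram \<mu> = {(i, j). i < size \<mu> \<and> j < rev (sorted_list_of_multiset \<mu>) ! i}"

definition semistandard :: "nat multiset \<Rightarrow> (nat \<times> nat \<Rightarrow> nat) set" where
  "semistandard \<mu> = {T \<in> extensional (diagram \<mu>).
     (\<forall>i j j'. (i, j) \<in> diagram \<mu> \<and> (i, j') \<in> diagram \<mu> \<and> j < j' \<longrightarrow> T (i, j) \<le> T (i, j')) \<and>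
     (\<forall>i i' j. (i, j) \<in> diagram \<mu> \<and> (i', j) \<in> diagram \<mu> \<and> i < i' \<longrightarrow> T (i, j) < T (i', j))}"

definition content :: "nat multiset \<Rightarrow> (nat \<times> nat \<Rightarrow> nat) \<Rightarrow> nat multiset" where
  "content \<mu> T = image_mset T (mset_set (diagram \<mu>))"

definition s_fun :: "nat multiset \<Rightarrow> complex mseries" where
  "s_fun \<mu> = Abs_mseries (\<lambda>m. of_nat (card {T \<in> semistandard \<mu>. content \<mu> T = m}))"


section \<open>Characters of permutation modules and the Frobenius characteristic\<close>

text \<open>
  The complex vector space with basis \<open>X\<close> consists of the finitely supported \<open>v\<close> with
  \<open>keys v \<subseteq> X\<close>. A self-map of \<open>X\<close> acts linearly on it by permuting basis vectors, and the
  character is the trace in the basis \<open>X\<close>.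
\<close>

definition perm_rep :: "('x \<Rightarrow> 'x) \<Rightarrow> ('x \<Rightarrow>\<^sub>0 complex) \<Rightarrow> ('x \<Rightarrow>\<^sub>0 complex)" where
  "perm_rep f v = (\<Sum>x\<in>Poly_Mapping.keys v. Poly_Mapping.single (f x) (Poly_Mapping.lookup v x))"

definition trace_on :: "'x set \<Rightarrow> (('x \<Rightarrow>\<^sub>0 complex) \<Rightarrow> ('x \<Rightarrow>\<^sub>0 complex)) \<Rightarrow> complex" where
  "trace_on X A = (\<Sum>x\<in>X. Poly_Mapping.lookup (A (Poly_Mapping.single x 1)) x)"

definition perm_character :: "'x set \<Rightarrow> ('g \<Rightarrow> 'x \<Rightarrow> 'x) \<Rightarrow> 'g \<Rightarrow> complex" where
  "perm_character X act \<sigma> = trace_on X (perm_rep (act \<sigma>))"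

text \<open>\<open>S\<^sub>n\<close> is realised as the set of \<open>\<sigma>\<close> with \<open>\<sigma> permutes {1..n}\<close>; fixed points count as cycles.\<close>

definition cycle_type :: "nat \<Rightarrow> (nat \<Rightarrow> nat) \<Rightarrow> nat multiset" where
  "cycle_type n \<sigma> = image_mset card (mset_set (orbit \<sigma> ` {1..n}))"

definition class_value :: "nat \<Rightarrow> ((nat \<Rightarrow> nat) \<Rightarrow> complex) \<Rightarrow> nat multiset \<Rightarrow> complex" where
  "class_value n \<chi> \<mu> = (THE c. \<forall>\<sigma>. \<sigma> permutes {1..n} \<and> cycle_type n \<sigma> = \<mu> \<longrightarrow> \<chi> \<sigma> = c)"

definition Frob :: "nat \<Rightarrow> ((nat \<Rightarrow> nat) \<Rightarrow> complex) \<Rightarrow> complex mseries" where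
  "Frob n \<chi> = (\<Sum>\<mu>\<in>partitions n. scale (class_value n \<chi> \<mu> / of_nat (zee \<mu>)) (p_fun \<mu>))"


section \<open>Rational parking functions\<close>

datatype step = North | East

text \<open>
  The point reached after \<open>k\<close> steps has as coordinates the numbers of east and north steps
  among the first \<open>k\<close>. Comparing these lattice points with the line suffices, as the segments
  between them are axis-parallel and the line has positive slope.
\<close>

definition dyck_paths :: "nat \<Rightarrow> nat \<Rightarrow> step list set" where
  "dyck_paths a b = {p. count_list p North = a \<and> count_list p East = b \<and>
     (\<forall>k\<le>length p. real (count_list (take k p) North) \<ge> real a / real b * real (count_list (take k p) East))}"

text \<open>The \<open>x\<close>-coordinates of the north steps, from bottom to top.\<close>

definition north_columns :: "step list \<Rightarrow> nat list" where
  "north_columns p =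
    map (\<lambda>k. count_list (take k p) East) (filter (\<lambda>k. p ! k = North) [0..<length p])"

text \<open>A labelling is the list \<open>w\<close> of the labels of the north steps, from bottom to top.\<close>

definition parking_functions :: "nat \<Rightarrow> nat \<Rightarrow> (step list \<times> nat list) set" where
  "parking_functions a b = {(p, w). p \<in> dyck_paths a b \<and>
     length w = a \<and> bij_betw (\<lambda>i. w ! i) {..<a} {1..a} \<and>
     (\<forall>i j. i < j \<and> j < a \<and> north_columns p ! i = north_columns p ! j \<longrightarrow> w ! i < w ! j)}"

definition column_labels :: "step list \<Rightarrow> nat list \<Rightarrow> nat \<Rightarrow> nat list" where
  "column_labels p w x = [w ! i. i \<leftarrow> [0..<length w], north_columns p ! i = x]"

text \<open>
  As the columns of the north steps weakly increase along the path, concatenating the sorted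
  columns from left to right lists the new labels from bottom to top.
\<close>

definition act_parking :: "(nat \<Rightarrow> nat) \<Rightarrow> step list \<times> nat list \<Rightarrow> step list \<times> nat list" where
  "act_parking \<sigma> = (\<lambda>(p, w).
     (p, concat (map (\<lambda>x. sort (map \<sigma> (column_labels p w x))) [0..<Suc (count_list p East)])))"

end

theory Submission
  imports
    Defs
    "HOL-Library.Product_Lexorder"
    "HOL-Combinatorics.Multiset_Permutations"
begin

text \<open>
  All three sums, and the Frobenius characteristic, equal \<open>1/b\<close> times the degree \<open>a\<close> part
  \<open>h\<^sub>a[bX]\<close> of \<open>\<Prod>\<^sub>i (1 - x\<^sub>i)\<^sup>-\<^sup>b\<close>, whose coefficient at a monomial \<open>m\<close> is
  \<open>\<Prod>\<^sub>i binomial (b + m\<^sub>i - 1) m\<^sub>i\<close>.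

  The power sum expansion follows from Newton's recursion
  \<open>n h\<^sub>n[bX] = b \<Sum>\<^sub>k p\<^sub>k h\<^bsub>n-k\<^esub>[bX]\<close>, and the expansion into products of complete homogeneous
  functions from \<open>h\<^sub>n[(b+1)X] = \<Sum>\<^sub>k h\<^sub>k h\<^bsub>n-k\<^esub>[bX]\<close> and Pascal's rule. The Schur expansion is
  the Cauchy identity with one alphabet specialised to \<open>b\<close> ones. Reading tableaux as chains of
  horizontal strips, it follows from the Pieri rule at \<open>1\<^sup>b\<close>, which is proved by a local bijection.

  A permutation \<open>\<sigma>\<close> fixes a parking function iff the map from labels to columns is constant on the
  cycles of \<open>\<sigma>\<close>. There are \<open>b\<^sup>\<ell>\<close> maps to \<open>{0..<b}\<close> constant on the \<open>\<ell>\<close> cycles. As \<open>a\<close> and \<open>b\<close> are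
  coprime, exactly one of the \<open>b\<close> cyclic shifts of such a map is a parking function, so the character
  at \<open>\<sigma>\<close> is \<open>b\<^bsup>\<ell>-1\<^esup>\<close>.
\<close>

section \<open>Coefficients of formal series\<close>

text \<open>The factor \<open>1/b\<close> is split off because only the undivided series
  \<open>h_copies b n\<close> satisfies recursions: in \<open>n\<close> for fixed \<open>b\<close>,
  and from \<open>b\<close> to \<open>b + 1\<close>. Its coefficients are explicit, so identities in
  infinitely many variables reduce to one monomial at a time, where finitely many variables occur.
  For the Schur side this asks that, for a monomial \<open>m\<close>, the sum over shapes
  \<open>l\<close> of the Kostka number of \<open>l\<close> and \<open>m\<close> times
  \<open>s_l(1^b)\<close> be the product of the \<open>multichoose b (count m i)\<close>. Removing
  one variable from \<open>m\<close> turns the sum over \<open>l\<close> into a single Pieri step at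
  \<open>1^b\<close>, so counting suffices and no insertion algorithm on pairs of tableaux has to be
  followed.\<close>

lemma coeff_zero [simp]: "coeff 0 m = 0"
  by (simp add: zero_mseries_def)

lemma coeff_plus [simp]: "coeff (f + g) m = coeff f m + coeff g m"
  by (simp add: plus_mseries_def)

lemma coeff_scale [simp]: "coeff (scale c f) m = c * coeff f m"
  by (simp add: scale_def)

lemma coeff_sum [simp]: "coeff (sum f A) m = (\<Sum>x\<in>A. coeff (f x) m)"
  by (induction A rule: infinite_finite_induct) auto

lemma coeff_times: "coeff (f * g) m = (\<Sum>(u, v)\<in>splits m. coeff f u * coeff g v)"
  by (simp add: times_mseries_def)

lemma scale_scale [simp]: "scale c (scale d f) = scale (c * d) f"
  by (rule mseries_eqI) simp

lemma scale_sum: "scale c (sum f A) = (\<Sum>x\<in>A. scale c (f x))"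
  by (rule mseries_eqI) (simp add: sum_distrib_left)

lemma scale_sum_left: "scale (sum c A) f = (\<Sum>x\<in>A. scale (c x) f)"
  by (rule mseries_eqI) (simp add: sum_distrib_right)

lemma scale_add_left: "scale (c + d) f = scale c f + scale d f"
  by (rule mseries_eqI) (simp add: distrib_right)

lemma scale_one [simp]: "scale 1 f = f"
  by (rule mseries_eqI) simp

lemma scale_zero [simp]: "scale 0 f = 0"
  by (rule mseries_eqI) simp

lemma times_scale: "f * scale c g = scale c (f * g)"
  by (rule mseries_eqI) (simp add: coeff_times sum_distrib_left case_prod_beta mult_ac)

lemma complete_homogeneous_0: "complete_homogeneous 0 = 1"
  by (simp add: complete_homogeneous_def one_mseries_def)

section \<open>Coefficients of products with a power sum or a complete homogeneous function\<close>

lemma finite_submultisets: "finite {v. v \<subseteq># (m :: nat multiset)}"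
  by (rule finite_subset[of _ "snd ` splits m"])
    (auto simp: splits_def image_iff finite_splits[unfolded splits_def] subset_mset.le_iff_add add.commute)

lemma sum_splits:
  "(\<Sum>(u, v)\<in>splits m. F u v) = (\<Sum>v | v \<subseteq># m. F (m - v) v)"
  by (rule sum.reindex_bij_witness[of _ "\<lambda>v. (m - v, v)" snd]) (auto simp: splits_def)

text \<open>For \<open>k > 0\<close> the variable \<open>i\<close> can be recovered from the
  monomial \<open>replicate_mset k i\<close>, so the contributing splittings of \<open>m\<close>
  correspond to the \<open>i\<close> of multiplicity at least \<open>k\<close>. For
  \<open>k = 0\<close> all these monomials would be \<open>{#}\<close>.\<close>

lemma coeff_power_sum_times:
  assumes "k > 0"
  shows "coeff (power_sum k * f) m
    = (\<Sum>i | i \<in># m \<and> k \<le> count m i. coeff f (m - replicate_mset k i))"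
proof -
  let ?I = "{i. i \<in># m \<and> k \<le> count m i}"
  let ?g = "\<lambda>i. (replicate_mset k i, m - replicate_mset k i)"
  have inj: "inj_on ?g ?I"
    using assms by (auto simp: inj_on_def) (metis in_replicate_mset)
  have "coeff (power_sum k * f) m = (\<Sum>(u, v)\<in>?g ` ?I. coeff (power_sum k) u * coeff f v)"
    unfolding coeff_times
  proof (rule sum.mono_neutral_right)
    show "finite (splits m)" by (rule finite_splits)
    show "?g ` ?I \<subseteq> splits m"
      by (auto simp: splits_def simp flip: count_le_replicate_mset_subset_eq)
    show "\<forall>x\<in>splits m - ?g ` ?I. (case x of (u, v) \<Rightarrow> coeff (power_sum k) u * coeff f v) = 0"
    proof
      fix x assume x: "x \<in> splits m - ?g ` ?I"
      obtain u v where uv: "x = (u, v)" by force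
      have "coeff (power_sum k) u = 0"
      proof (rule ccontr)
        assume "coeff (power_sum k) u \<noteq> 0"
        then obtain i where i: "u = replicate_mset k i"
          by (auto simp: power_sum_def split: if_splits)
        have m: "m = u + v" using x uv by (auto simp: splits_def)
        have "i \<in> ?I" "x = ?g i"
          using i m uv assms by auto
        with x show False by blast
      qed
      then show "(case x of (u, v) \<Rightarrow> coeff (power_sum k) u * coeff f v) = 0"
        by (simp add: uv)
    qed
  qed
  also have "\<dots> = (\<Sum>i\<in>?I. coeff f (m - replicate_mset k i))"
    by (subst sum.reindex[OF inj]) (auto simp: power_sum_def intro!: sum.cong)
  finally show ?thesis .
qed

lemma coeff_complete_homogeneous_times:
  "coeff (complete_homogeneous k * f) m = (\<Sum>v | v \<subseteq># m \<and> size v + k = size m. coeff f v)"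
proof -
  have "coeff (complete_homogeneous k * f) m
      = (\<Sum>v | v \<subseteq># m. if size v + k = size m then coeff f v else 0)"
    unfolding coeff_times sum_splits
  proof (intro sum.cong refl)
    fix v assume "v \<in> {v. v \<subseteq># m}"
    then have "size (m - v) = k \<longleftrightarrow> size v + k = size m"
      using size_Diff_submset[of v m] size_mset_mono[of v m] by auto
    then show "coeff (complete_homogeneous k) (m - v) * coeff f v
        = (if size v + k = size m then coeff f v else 0)"
      by (simp add: complete_homogeneous_def)
  qed
  also have "\<dots> = (\<Sum>v | v \<subseteq># m \<and> size v + k = size m. coeff f v)"
    using sum.inter_filter[OF finite_submultisets[of m], of "coeff f" "\<lambda>v. size v + k = size m"] by simp
  finally show ?thesis .
qed

text \<open>A submultiset of \<open>m\<close> is an independent choice of a multiplicity up to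
  \<open>count m i\<close> for each \<open>i\<close>, so the equation is the distributive
  law.\<close>

lemma sum_submultisets_prod:
  fixes g :: "'b \<Rightarrow> nat \<Rightarrow> 'c :: comm_semiring_1"
  shows "(\<Sum>v | v \<subseteq># m. \<Prod>i\<in>set_mset m. g i (count v i))
    = (\<Prod>i\<in>set_mset m. \<Sum>k\<le>count m i. g i k)"
proof -
  let ?P = "\<Pi>\<^sub>E i\<in>set_mset m. {..count m i}"
  let ?F = "\<lambda>f. \<Sum>i\<in>set_mset m. replicate_mset (f i) i"
  have cnt: "count (?F f) i = (if i \<in># m then f i else 0)" for f :: "'b \<Rightarrow> nat" and i
    by (simp add: count_sum)
  have "(\<Sum>v | v \<subseteq># m. \<Prod>i\<in>set_mset m. g i (count v i)) = (\<Sum>f\<in>?P. \<Prod>i\<in>set_mset m. g i (f i))"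
  proof (rule sum.reindex_bij_witness[of _ ?F "\<lambda>v. restrict (count v) (set_mset m)"])
    fix f assume "f \<in> ?P"
    then show "?F f \<in> {v. v \<subseteq># m}"
      by (auto simp: subseteq_mset_def cnt PiE_iff not_in_iff)
    show "restrict (count (?F f)) (set_mset m) = f"
      using \<open>f \<in> ?P\<close> by (intro ext) (auto simp: cnt PiE_iff extensional_def restrict_def)
  next
    fix v assume v: "v \<in> {v. v \<subseteq># m}"
    show "restrict (count v) (set_mset m) \<in> ?P"
      using v by (auto simp: mset_subset_eq_count)
    show "?F (restrict (count v) (set_mset m)) = v"
    proof (rule multiset_eqI)
      fix i
      show "count (?F (restrict (count v) (set_mset m))) i = count v i"
        using v mset_subset_eq_count[of v m i] by (auto simp: cnt not_in_iff)
    qed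
  qed (auto intro!: prod.cong)
  also have "\<dots> = (\<Prod>i\<in>set_mset m. \<Sum>k\<le>count m i. g i k)"
    by (rule prod_sum_PiE[symmetric]) auto
  finally show ?thesis .
qed

section \<open>The symmetric function \<open>h\<^sub>n[bX]\<close> and its power sum and homogeneous expansions\<close>

text \<open>Coefficient of \<open>x^k\<close> in \<open>(1 - x)^(-b)\<close>. Truncated subtraction
  handles \<open>b = 0\<close>: the value is 1 at \<open>k = 0\<close> and
  \<open>(k - 1) choose k = 0\<close> afterwards.\<close>

definition multichoose :: "nat \<Rightarrow> nat \<Rightarrow> nat" where
  "multichoose b k = (b + k - 1) choose k"

lemma multichoose_0_right [simp]: "multichoose b 0 = 1"
  by (simp add: multichoose_def)

lemma multichoose_0_left: "multichoose 0 k = (if k = 0 then 1 else 0)"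
  by (simp add: multichoose_def)

lemma multichoose_Suc: "multichoose (Suc b) k = (\<Sum>j\<le>k. multichoose b j)"
proof (cases b)
  case 0
  then show ?thesis by (simp add: multichoose_0_left) (simp add: multichoose_def)
next
  case (Suc r)
  then show ?thesis
    using sum_choose_lower[of r k] by (simp add: multichoose_def)
qed

text \<open>Comparison of coefficients in \<open>x * G' = b * (x / (1 - x)) * G\<close> for
  \<open>G = (1 - x)^(-b)\<close>; this is Newton's recursion in a single variable.\<close>

lemma multichoose_absorb: "k * multichoose b k = b * (\<Sum>j<k. multichoose b j)"
proof (cases k)
  case (Suc l)
  have "(\<Sum>j<k. multichoose b j) = multichoose (Suc b) l"
    by (simp add: Suc multichoose_Suc lessThan_Suc_atMost)
  moreover have "Suc l * multichoose b (Suc l) = b * multichoose (Suc b) l"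
    using binomial_absorb_comp[of "b + l" l] binomial_absorption[of l "b + l"] 
    by (cases b) (simp_all add: multichoose_def)
  ultimately show ?thesis by (simp add: Suc)
qed simp

definition multichoose_weight :: "nat \<Rightarrow> 'b multiset \<Rightarrow> nat" where
  "multichoose_weight b m = (\<Prod>i\<in>set_mset m. multichoose b (count m i))"

lemma multichoose_weight_superset:
  assumes "finite A" "set_mset m \<subseteq> A"
  shows "multichoose_weight b m = (\<Prod>i\<in>A. multichoose b (count m i))"
  unfolding multichoose_weight_def using assms
  by (intro prod.mono_neutral_left) (auto simp: not_in_iff)

lemma multichoose_weight_diff_replicate:
  assumes "i \<in># m"
  shows "multichoose_weight b (m - replicate_mset k i)
    = multichoose b (count m i - k) * (\<Prod>j\<in>set_mset m - {i}. multichoose b (count m j))"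
proof -
  have "multichoose_weight b (m - replicate_mset k i)
      = (\<Prod>j\<in>set_mset m. multichoose b (count (m - replicate_mset k i) j))"
    by (rule multichoose_weight_superset) (auto dest: in_diffD)
  also have "\<dots> = multichoose b (count m i - k) *
      (\<Prod>j\<in>set_mset m - {i}. multichoose b (count (m - replicate_mset k i) j))"
    using assms by (subst prod.remove[of _ i]) auto
  also have "(\<Prod>j\<in>set_mset m - {i}. multichoose b (count (m - replicate_mset k i) j))
      = (\<Prod>j\<in>set_mset m - {i}. multichoose b (count m j))"
    by (intro prod.cong) auto
  finally show ?thesis .
qed

text \<open>For a fixed \<open>i\<close> only the factor at \<open>i\<close> changes with
  \<open>k\<close>, so \<open>multichoose_absorb\<close> gives \<open>count m i\<close> times the
  weight; the multiplicities add up to \<open>size m\<close>.\<close>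

lemma multichoose_weight_Newton:
  "size m * multichoose_weight b m
    = b * (\<Sum>i\<in>set_mset m. \<Sum>k\<in>{1..count m i}. multichoose_weight b (m - replicate_mset k i))"
proof -
  have "b * (\<Sum>k\<in>{1..count m i}. multichoose_weight b (m - replicate_mset k i)) = count m i * multichoose_weight b m"
    if i: "i \<in># m" for i
  proof -
    let ?R = "\<Prod>j\<in>set_mset m - {i}. multichoose b (count m j)"
    have "(\<Sum>k\<in>{1..count m i}. multichoose_weight b (m - replicate_mset k i))
        = (\<Sum>k\<in>{1..count m i}. multichoose b (count m i - k)) * ?R"
      by (simp add: multichoose_weight_diff_replicate[OF i] sum_distrib_right)
    also have "(\<Sum>k\<in>{1..count m i}. multichoose b (count m i - k)) = (\<Sum>j<count m i. multichoose b j)"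
      by (rule sum.reindex_bij_witness[of _ "\<lambda>j. count m i - j" "\<lambda>k. count m i - k"]) auto
    finally have "b * (\<Sum>k\<in>{1..count m i}. multichoose_weight b (m - replicate_mset k i))
        = count m i * (multichoose b (count m i) * ?R)"
      using multichoose_absorb[of "count m i" b] by (metis mult.assoc)
    also have "multichoose b (count m i) * ?R = multichoose_weight b m"
      unfolding multichoose_weight_def using i by (intro prod.remove[symmetric]) auto
    finally show ?thesis .
  qed
  then show ?thesis
    by (simp add: sum_distrib_left size_multiset_overloaded_eq sum_distrib_right)
qed

text \<open>One more copy multiplies the series of each variable by \<open>1 / (1 - x)\<close>,
  which replaces coefficients by partial sums: this is \<open>multichoose_Suc\<close> in every
  variable at once.\<close>

lemma multichoose_weight_Suc: "multichoose_weight (Suc b) m = (\<Sum>v | v \<subseteq># m. multichoose_weight b v)"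
proof -
  have "(\<Sum>v | v \<subseteq># m. multichoose_weight b v) = (\<Sum>v | v \<subseteq># m. \<Prod>i\<in>set_mset m. multichoose b (count v i))"
    by (intro sum.cong refl multichoose_weight_superset) (auto dest: mset_subset_eqD)
  then show ?thesis
    by (simp add: sum_submultisets_prod[where g = "\<lambda>_. multichoose b"] multichoose_weight_def multichoose_Suc)
qed

text \<open>The degree \<open>n\<close> part of \<open>\<Prod>\<^sub>i (1 - x\<^sub>i)\<^sup>-\<^sup>b\<close>, that is, \<open>h\<^sub>n[bX]\<close> in plethystic notation.\<close>

definition h_copies :: "nat \<Rightarrow> nat \<Rightarrow> complex mseries" where
  "h_copies b n = Abs_mseries (\<lambda>m. if size m = n then of_nat (multichoose_weight b m) else 0)"

lemma coeff_h_copies: "coeff (h_copies b n) m = (if size m = n then of_nat (multichoose_weight b m) else 0)"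
  by (simp add: h_copies_def)

lemma h_copies_0_right: "h_copies b 0 = 1"
  by (rule mseries_eqI) (auto simp: coeff_h_copies one_mseries_def multichoose_weight_def)

lemma h_copies_0_left: "h_copies 0 n = (if n = 0 then 1 else 0)"
proof (cases "n = 0")
  case False
  have "multichoose_weight 0 m = 0" if m: "size m = n" for m :: "nat multiset"
  proof -
    obtain i where "i \<in># m" using m False by (metis multiset_nonemptyE size_empty)
    then show ?thesis by (auto simp: multichoose_weight_def multichoose_0_left)
  qed
  then show ?thesis
    using False by (auto intro!: mseries_eqI simp: coeff_h_copies)
qed (simp add: h_copies_0_right)

lemma h_copies_Newton:
  "scale (of_nat n) (h_copies b n) = scale (of_nat b) (\<Sum>k=1..n. power_sum k * h_copies b (n - k))"
proof (rule mseries_eqI)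
  fix m
  have *: "coeff (\<Sum>k=1..n. power_sum k * h_copies b (n - k)) m
      = (\<Sum>k=1..n. \<Sum>i | i \<in># m \<and> k \<le> count m i. coeff (h_copies b (n - k)) (m - replicate_mset k i))"
    by (simp add: coeff_power_sum_times)
  have sz: "size (m - replicate_mset k i) = size m - k" "k \<le> size m"
    if "i \<in># m" "k \<le> count m i" for i k
    using that count_le_size[of m i] count_le_replicate_mset_subset_eq[of k m i] 
    by (auto simp: size_Diff_submset)
  show "coeff (scale (of_nat n) (h_copies b n)) m
      = coeff (scale (of_nat b) (\<Sum>k=1..n. power_sum k * h_copies b (n - k))) m"
  proof (cases "size m = n")
    case False
    have "(\<Sum>k=1..n. \<Sum>i | i \<in># m \<and> k \<le> count m i. coeff (h_copies b (n - k)) (m - replicate_mset k i)) = 0"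
    proof (intro sum.neutral ballI)
      fix k i assume "k \<in> {1..n}" "i \<in> {i. i \<in># m \<and> k \<le> count m i}"
      then show "coeff (h_copies b (n - k)) (m - replicate_mset k i) = 0"
        using sz[of i k] False by (auto simp: coeff_h_copies)
    qed
    then show ?thesis unfolding coeff_scale * using False by (simp add: coeff_h_copies)
  next
    case True
    have "(\<Sum>k=1..n. \<Sum>i | i \<in># m \<and> k \<le> count m i. coeff (h_copies b (n - k)) (m - replicate_mset k i))
      = (\<Sum>k=1..n. \<Sum>i | i \<in> set_mset m \<and> k \<le> count m i. of_nat (multichoose_weight b (m - replicate_mset k i)))"
      using sz True by (intro sum.cong refl) (auto simp: coeff_h_copies)
    also have "\<dots> = (\<Sum>i\<in>set_mset m. \<Sum>k | k \<in> {1..n} \<and> k \<le> count m i. of_nat (multichoose_weight b (m - replicate_mset k i)))"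
      by (rule sum.swap_restrict) auto
    also have "\<dots> = (\<Sum>i\<in>set_mset m. \<Sum>k\<in>{1..count m i}. of_nat (multichoose_weight b (m - replicate_mset k i)))"
    proof (intro sum.cong refl)
      fix i show "{k \<in> {1..n}. k \<le> count m i} = {1..count m i}"
        using count_le_size[of m i] True by auto
    qed
    finally have "coeff (scale (of_nat b) (\<Sum>k=1..n. power_sum k * h_copies b (n - k))) m
        = of_nat (b * (\<Sum>i\<in>set_mset m. \<Sum>k\<in>{1..count m i}. multichoose_weight b (m - replicate_mset k i)))"
      unfolding coeff_scale * by simp
    then show ?thesis
      unfolding multichoose_weight_Newton[symmetric] by (simp add: coeff_h_copies True)
  qed
qed

text \<open>The factor for the extra copy is the product of all \<open>1 / (1 - x_i)\<close>, that
  is, the sum of all \<open>h_k\<close>; in coefficients, \<open>k\<close> is the degree of the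
  complement of \<open>v\<close> in \<open>m\<close>.\<close>

lemma h_copies_Suc: "h_copies (Suc b) n = (\<Sum>k\<le>n. complete_homogeneous k * h_copies b (n - k))"
proof (rule mseries_eqI)
  fix m
  have "coeff (\<Sum>k\<le>n. complete_homogeneous k * h_copies b (n - k)) m
      = (\<Sum>k\<le>n. \<Sum>v | v \<subseteq># m \<and> size v + k = size m. coeff (h_copies b (n - k)) v)"
    by (simp add: coeff_complete_homogeneous_times)
  also have "\<dots> = (if size m = n then of_nat (multichoose_weight (Suc b) m) else 0)"
  proof (cases "size m = n")
    case True
    have "(\<Sum>k\<le>n. \<Sum>v | v \<subseteq># m \<and> size v + k = size m. coeff (h_copies b (n - k)) v)
        = (\<Sum>k\<le>n. \<Sum>v | v \<in> {v. v \<subseteq># m} \<and> n - size v = k. of_nat (multichoose_weight b v))"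
      using True size_mset_mono[of _ m]
      by (intro sum.cong refl) (auto simp: coeff_h_copies)
    also have "\<dots> = (\<Sum>v | v \<subseteq># m. of_nat (multichoose_weight b v))"
      by (rule sum.group) (auto simp: finite_submultisets)
    finally show ?thesis using True by (simp add: multichoose_weight_Suc)
  next
    case False
    then show ?thesis by (auto simp: coeff_h_copies intro!: sum.neutral)
  qed
  finally show "coeff (h_copies (Suc b) n) m = coeff (\<Sum>k\<le>n. complete_homogeneous k * h_copies b (n - k)) m"
    by (simp add: coeff_h_copies)
qed

section \<open>Removing one part from a partition; the power sum expansion\<close>

lemma sum_mset_eq_sum_count:
  fixes \<mu> :: "nat multiset"
  assumes "finite A" "set_mset \<mu> \<subseteq> A"
  shows "sum_mset \<mu> = (\<Sum>j\<in>A. count \<mu> j * j)"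
  using assms(2)
proof (induction \<mu>)
  case (add j \<mu>)
  have "(\<Sum>i\<in>A. count (add_mset j \<mu>) i * i) = (\<Sum>i\<in>A. (if j = i then i else 0) + count \<mu> i * i)"
    by (intro sum.cong) auto
  then show ?case
    using add assms(1) by (simp add: sum.distrib)
qed simp

text \<open>Adding \<open>j\<close> to \<open>\<nu>\<close> inverts the removal. What is
  distinguished is a part size, not an occurrence, so multiplicities have to be supplied by the
  summand. Both the power sum and the homogeneous recursion are sums of this kind.\<close>

lemma sum_partitions_remove:
  "(\<Sum>\<mu>\<in>partitions n. \<Sum>j\<in>set_mset \<mu>. F j (\<mu> - {#j#})) = (\<Sum>j=1..n. \<Sum>\<nu>\<in>partitions (n - j). F j \<nu>)"
proof -
  have "(\<Sum>\<mu>\<in>partitions n. \<Sum>j\<in>set_mset \<mu>. F j (\<mu> - {#j#}))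
      = (\<Sum>(\<mu>, j)\<in>Sigma (partitions n) set_mset. F j (\<mu> - {#j#}))"
    by (rule sum.Sigma) (auto simp: finite_partitions)
  also have "\<dots> = (\<Sum>(j, \<nu>)\<in>Sigma {1..n} (\<lambda>j. partitions (n - j)). F j \<nu>)"
  proof (rule sum.reindex_bij_witness[of _ "\<lambda>(j, \<nu>). (add_mset j \<nu>, j)" "\<lambda>(\<mu>, j). (j, \<mu> - {#j#})"])
    fix x assume "x \<in> Sigma (partitions n) set_mset"
    then obtain \<mu> j where x: "x = (\<mu>, j)" "j \<in># \<mu>" "0 \<notin># \<mu>" "sum_mset \<mu> = n"
      by (auto simp: partitions_def)
    then obtain \<nu> where "\<mu> = add_mset j \<nu>" by (metis insert_DiffM)
    with x show "(case x of (\<mu>, j) \<Rightarrow> (j, \<mu> - {#j#})) \<in> Sigma {1..n} (\<lambda>j. partitions (n - j))"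
      by (auto simp: partitions_def)
  qed (auto simp: partitions_def)
  also have "\<dots> = (\<Sum>j=1..n. \<Sum>\<nu>\<in>partitions (n - j). F j \<nu>)"
    by (rule sum.Sigma[symmetric]) (auto simp: finite_partitions)
  finally show ?thesis .
qed

lemma zee_superset:
  assumes "finite A" "set_mset \<mu> \<subseteq> A"
  shows "zee \<mu> = (\<Prod>j\<in>A. j ^ count \<mu> j * fact (count \<mu> j))"
  unfolding zee_def using assms
  by (intro prod.mono_neutral_left) (auto simp: not_in_iff)

lemma zee_add_mset: "zee (add_mset j \<nu>) = j * Suc (count \<nu> j) * zee \<nu>"
proof -
  let ?A = "insert j (set_mset \<nu>)"
  have "zee (add_mset j \<nu>)
      = j ^ Suc (count \<nu> j) * fact (Suc (count \<nu> j)) * (\<Prod>i\<in>?A - {j}. i ^ count \<nu> i * fact (count \<nu> i))"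
    by (subst zee_superset[of ?A], simp, simp, subst prod.remove[of _ j])
      (auto intro!: prod.cong)
  moreover have "zee \<nu> = j ^ count \<nu> j * fact (count \<nu> j) * (\<Prod>i\<in>?A - {j}. i ^ count \<nu> i * fact (count \<nu> i))"
    by (subst zee_superset[of ?A], simp, blast, subst prod.remove[of _ j]) auto
  ultimately show ?thesis by (simp add: algebra_simps)
qed

lemma zee_pos: "0 \<notin># \<mu> \<Longrightarrow> zee \<mu> > 0"
  unfolding zee_def by (rule prod_pos) (auto intro!: Nat.gr0I)

text \<open>Multiply by \<open>n\<close>, written as the sum of \<open>count \<mu> j * j\<close>
  over the part sizes \<open>j\<close>. By \<open>zee_add_mset\<close> this weight turns the
  coefficient of \<open>\<mu>\<close> into \<open>b\<close> times that of
  \<open>\<mu> - {#j#}\<close>, so the left side obeys Newton's recursion.\<close>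

lemma p_expansion_h_copies:
  "(\<Sum>\<mu>\<in>partitions n. scale (of_nat b ^ size \<mu> / of_nat (zee \<mu>)) (p_fun \<mu>)) = h_copies b n"
proof (induction n rule: less_induct)
  case (less n)
  let ?t = "\<lambda>\<mu>. scale (of_nat b ^ size \<mu> / of_nat (zee \<mu>)) (p_fun \<mu>) :: complex mseries"
  show ?case
  proof (cases "n = 0")
    case True
    have "partitions 0 = {{#}}"
      by (auto simp: partitions_def) (metis multiset_nonemptyE)
    then show ?thesis by (simp add: True h_copies_0_right zee_def p_fun_def)
  next
    case False
    have "scale (of_nat n) (\<Sum>\<mu>\<in>partitions n. ?t \<mu>)
        = (\<Sum>\<mu>\<in>partitions n. \<Sum>j\<in>set_mset \<mu>. scale (of_nat b) (power_sum j * ?t (\<mu> - {#j#})))"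
      unfolding scale_sum
    proof (intro sum.cong refl)
      fix \<mu> assume \<mu>: "\<mu> \<in> partitions n"
      have "scale (of_nat b) (power_sum j * ?t (\<mu> - {#j#})) = scale (of_nat (count \<mu> j * j)) (?t \<mu>)"
        if j: "j \<in># \<mu>" for j
      proof -
        obtain \<nu> where \<nu>: "\<mu> = add_mset j \<nu>" using j by (metis insert_DiffM)
        have "j > 0" "zee \<nu> > 0"
          using \<mu> zee_pos[of \<nu>] by (auto simp: \<nu> partitions_def)
        then have "of_nat b * (of_nat b ^ size \<nu> / of_nat (zee \<nu>))
            = of_nat (count \<mu> j * j) * (of_nat b ^ size \<mu> / of_nat (zee \<mu>) :: complex)"
          using of_nat_neq_0[of "count \<nu> j", where 'a = complex]
          by (simp add: \<nu> zee_add_mset divide_simps del: of_nat_Suc mult_Suc_right) (simp add: algebra_simps)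
        then show ?thesis by (simp add: \<nu> p_fun_def times_scale)
      qed
      then have "(\<Sum>j\<in>set_mset \<mu>. scale (of_nat b) (power_sum j * ?t (\<mu> - {#j#})))
          = scale (of_nat (\<Sum>j\<in>set_mset \<mu>. count \<mu> j * j)) (?t \<mu>)"
        by (simp add: scale_sum_left sum_distrib_right sum_divide_distrib)
      also have "(\<Sum>j\<in>set_mset \<mu>. count \<mu> j * j) = n"
        using \<mu> by (simp add: partitions_def sum_mset_eq_sum_count[of "set_mset \<mu>"])
      finally show "scale (of_nat n) (?t \<mu>)
          = (\<Sum>j\<in>set_mset \<mu>. scale (of_nat b) (power_sum j * ?t (\<mu> - {#j#})))" ..
    qed
    also have "\<dots> = (\<Sum>j=1..n. \<Sum>\<nu>\<in>partitions (n - j). scale (of_nat b) (power_sum j * ?t \<nu>))"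
      by (rule sum_partitions_remove[where F = "\<lambda>j \<nu>. scale (of_nat b) (power_sum j * ?t \<nu>)"])
    also have "\<dots> = (\<Sum>j=1..n. scale (of_nat b) (power_sum j * h_copies b (n - j)))"
    proof (intro sum.cong refl)
      fix j assume "j \<in> {1..n}"
      then have "(\<Sum>\<nu>\<in>partitions (n - j). ?t \<nu>) = h_copies b (n - j)"
        using False by (intro less.IH) auto
      then show "(\<Sum>\<nu>\<in>partitions (n - j). scale (of_nat b) (power_sum j * ?t \<nu>))
          = scale (of_nat b) (power_sum j * h_copies b (n - j))"
        by (simp add: scale_sum[symmetric] sum_distrib_left[symmetric] del: scale_scale)
    qed
    also have "\<dots> = scale (of_nat n) (h_copies b n)"
      by (simp add: h_copies_Newton scale_sum)
    finally have "scale (1 / of_nat n) (scale (of_nat n) (\<Sum>\<mu>\<in>partitions n. ?t \<mu>))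
        = scale (1 / of_nat n) (scale (of_nat n) (h_copies b n))"
      by (rule arg_cong)
    then show ?thesis using False by simp
  qed
qed

section \<open>Multinomial coefficients and the homogeneous expansion\<close>

definition multinomial_coeff :: "nat \<Rightarrow> 'b multiset \<Rightarrow> complex" where
  "multinomial_coeff b \<mu> = (if size \<mu> \<le> b
     then fact b / (fact (b - size \<mu>) * (\<Prod>j\<in>set_mset \<mu>. fact (count \<mu> j))) else 0)"

lemma prod_fact_count_add_mset:
  "(\<Prod>i\<in>set_mset (add_mset j \<nu>). fact (count (add_mset j \<nu>) i))
    = of_nat (Suc (count \<nu> j)) * (\<Prod>i\<in>set_mset \<nu>. fact (count \<nu> i) :: complex)"
proof -
  let ?A = "insert j (set_mset \<nu>)"
  have "(\<Prod>i\<in>set_mset (add_mset j \<nu>). fact (count (add_mset j \<nu>) i) :: complex)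
      = fact (Suc (count \<nu> j)) * (\<Prod>i\<in>?A - {j}. fact (count \<nu> i))"
  proof -
    have "(\<Prod>i\<in>?A - {j}. fact (count (add_mset j \<nu>) i) :: complex) = (\<Prod>i\<in>?A - {j}. fact (count \<nu> i))"
      by (intro prod.cong) auto
    then show ?thesis by (subst prod.remove[of _ j]) auto
  qed
  moreover have "(\<Prod>i\<in>set_mset \<nu>. fact (count \<nu> i) :: complex) = (\<Prod>i\<in>?A. fact (count \<nu> i))"
    by (intro prod.mono_neutral_left) (auto simp: not_in_iff)
  moreover have "\<dots> = fact (count \<nu> j) * (\<Prod>i\<in>?A - {j}. fact (count \<nu> i))"
    by (subst prod.remove[of _ j]) auto
  ultimately show ?thesis by simp
qed

text \<open>The coefficient counts the words of length \<open>b\<close> made of the parts of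
  \<open>\<mu>\<close> and padding: the last letter of a word of length \<open>b + 1\<close> is
  padding or some part \<open>j\<close>. Algebraically, the multiplicities sum to
  \<open>size \<mu>\<close>, and \<open>(b + 1 - size \<mu>) + size \<mu> = b + 1\<close>.\<close>

lemma multinomial_coeff_Suc:
  "multinomial_coeff (Suc b) \<mu> = multinomial_coeff b \<mu> + (\<Sum>j\<in>set_mset \<mu>. multinomial_coeff b (\<mu> - {#j#}))"
proof -
  let ?P = "\<Prod>j\<in>set_mset \<mu>. fact (count \<mu> j) :: complex"
  have P: "?P \<noteq> 0" by simp
  have rem: "multinomial_coeff b (\<mu> - {#j#})
      = (if size \<mu> \<le> Suc b then of_nat (count \<mu> j) * fact b / (fact (Suc b - size \<mu>) * ?P) else 0)"
    if j: "j \<in># \<mu>" for j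
  proof -
    obtain \<nu> where \<nu>: "\<mu> = add_mset j \<nu>" using j by (metis insert_DiffM)
    have "?P = of_nat (Suc (count \<nu> j)) * (\<Prod>i\<in>set_mset \<nu>. fact (count \<nu> i))"
      unfolding \<nu> by (rule prod_fact_count_add_mset)
    then show ?thesis
      by (simp add: multinomial_coeff_def \<nu> del: of_nat_Suc set_mset_add_mset_insert)
  qed
  have "(\<Sum>j\<in>set_mset \<mu>. multinomial_coeff b (\<mu> - {#j#}))
      = (if size \<mu> \<le> Suc b then of_nat (size \<mu>) * fact b / (fact (Suc b - size \<mu>) * ?P) else 0)"
    by (simp add: rem size_multiset_overloaded_eq sum_distrib_right sum_divide_distrib)
  moreover consider "size \<mu> \<le> b" | "size \<mu> = Suc b" | "size \<mu> > Suc b" by linarith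
  then have "multinomial_coeff (Suc b) \<mu> = multinomial_coeff b \<mu> +
      (if size \<mu> \<le> Suc b then of_nat (size \<mu>) * fact b / (fact (Suc b - size \<mu>) * ?P) else 0)"
  proof cases
    case 1
    then obtain d where d: "b = size \<mu> + d" by (metis le_iff_add)
    have "Suc b - size \<mu> = Suc d" "b - size \<mu> = d" using d by auto
    then show ?thesis
      using P d of_nat_neq_0[of d, where 'a = complex]
      by (simp add: multinomial_coeff_def divide_simps) (simp add: algebra_simps)
  qed (simp_all add: multinomial_coeff_def)
  ultimately show ?thesis by simp
qed

text \<open>Induction on the number of copies. In \<open>h_copies_Suc\<close> the last copy
  contributes \<open>h_0 = 1\<close> or some \<open>h_j\<close> with \<open>j > 0\<close>, the same
  alternative as in Pascal's rule.\<close>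

lemma h_expansion_h_copies: "(\<Sum>\<mu>\<in>partitions n. scale (multinomial_coeff b \<mu>) (h_fun \<mu>)) = h_copies b n"
proof (induction b arbitrary: n)
  case 0
  have part0: "partitions 0 = {{#}}"
    by (auto simp: partitions_def) (metis multiset_nonemptyE)
  show ?case
  proof (cases "n = 0")
    case True
    then show ?thesis by (simp add: part0 h_copies_0_right multinomial_coeff_def h_fun_def)
  next
    case False
    then have "multinomial_coeff 0 \<mu> = 0" if "\<mu> \<in> partitions n" for \<mu>
      using that by (auto simp: multinomial_coeff_def partitions_def)
    then show ?thesis using False by (simp add: h_copies_0_left)
  qed
next
  case (Suc b)
  have "(\<Sum>\<mu>\<in>partitions n. scale (multinomial_coeff (Suc b) \<mu>) (h_fun \<mu>))
      = (\<Sum>\<mu>\<in>partitions n. scale (multinomial_coeff b \<mu>) (h_fun \<mu>))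
      + (\<Sum>\<mu>\<in>partitions n. \<Sum>j\<in>set_mset \<mu>.
          complete_homogeneous j * scale (multinomial_coeff b (\<mu> - {#j#})) (h_fun (\<mu> - {#j#})))"
  proof -
    have "h_fun \<mu> = complete_homogeneous j * h_fun (\<mu> - {#j#})" if "j \<in># \<mu>" for \<mu> j
      using that by (metis h_fun_def image_mset_add_mset insert_DiffM prod_mset.add_mset)
    then have "scale (\<Sum>j\<in>set_mset \<mu>. multinomial_coeff b (\<mu> - {#j#})) (h_fun \<mu>)
        = (\<Sum>j\<in>set_mset \<mu>. complete_homogeneous j * scale (multinomial_coeff b (\<mu> - {#j#})) (h_fun (\<mu> - {#j#})))" for \<mu>
      by (simp add: scale_sum_left times_scale)
    then show ?thesis
      by (simp add: multinomial_coeff_Suc scale_add_left sum.distrib)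
  qed
  also have "(\<Sum>\<mu>\<in>partitions n. \<Sum>j\<in>set_mset \<mu>.
          complete_homogeneous j * scale (multinomial_coeff b (\<mu> - {#j#})) (h_fun (\<mu> - {#j#})))
      = (\<Sum>j=1..n. complete_homogeneous j * h_copies b (n - j))"
    using sum_partitions_remove[where F = "\<lambda>j \<nu>. complete_homogeneous j * scale (multinomial_coeff b \<nu>) (h_fun \<nu>)"]
    by (simp add: sum_distrib_left[symmetric] Suc.IH)
  also have "(\<Sum>\<mu>\<in>partitions n. scale (multinomial_coeff b \<mu>) (h_fun \<mu>)) = h_copies b n"
    by (rule Suc.IH)
  also have "h_copies b n + (\<Sum>j=1..n. complete_homogeneous j * h_copies b (n - j)) = h_copies (Suc b) n"
  proof -
    have "{..n} = insert 0 {1..n}" by auto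
    then show ?thesis by (simp add: h_copies_Suc complete_homogeneous_0)
  qed
  finally show ?case .
qed

text \<open>The natural division in \<open>multinomial\<close> is exact, because the quotient counts
  the arrangements of a multiset of size \<open>b\<close>: the parts of \<open>\<mu>\<close> padded
  by \<open>b - size \<mu>\<close> further elements.\<close>

lemma multinomial_eq_multinomial_coeff:
  assumes "\<mu> \<in> partitions a"
  shows "of_nat (multinomial b ((int b - int (size \<mu>)) # map (\<lambda>j. int (count \<mu> j)) [1..<Suc a]))
    = multinomial_coeff b \<mu>"
proof (cases "size \<mu> \<le> b")
  case False
  then show ?thesis by (auto simp: multinomial_def multinomial_coeff_def)
next
  case True
  \<comment> \<open>0 is not a part, so it can serve as the padding symbol without changing the
    other multiplicities.\<close>
  let ?A = "\<mu> + replicate_mset (b - size \<mu>) 0"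
  have z: "count \<mu> 0 = 0" using assms by (simp add: partitions_def count_eq_zero_iff)
  have sub: "set_mset \<mu> \<subseteq> {1..<Suc a}"
  proof
    fix j assume "j \<in># \<mu>"
    then obtain \<nu> where "\<mu> = add_mset j \<nu>" by (metis insert_DiffM)
    with assms show "j \<in> {1..<Suc a}" by (auto simp: partitions_def)
  qed
  have P: "(\<Prod>j\<in>set_mset \<mu>. fact (count \<mu> j)) = (\<Prod>j\<in>{1..<Suc a}. fact (count \<mu> j) :: nat)"
    using sub by (intro prod.mono_neutral_left) (auto simp: not_in_iff)
  have "(\<Prod>x\<in>set_mset ?A. fact (count ?A x)) = (\<Prod>x\<in>insert 0 (set_mset \<mu>). fact (count ?A x) :: nat)"
    by (intro prod.mono_neutral_left) (auto simp: not_in_iff)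
  also have "\<dots> = fact (b - size \<mu>) * (\<Prod>j\<in>set_mset \<mu>. fact (count \<mu> j))"
  proof -
    have "(\<Prod>j\<in>set_mset \<mu>. fact (count ?A j)) = (\<Prod>j\<in>set_mset \<mu>. fact (count \<mu> j) :: nat)"
      using z by (intro prod.cong) (auto simp: count_eq_zero_iff)
    then show ?thesis using assms z by (subst prod.insert) (simp_all add: partitions_def)
  qed
  finally have "fact (b - size \<mu>) * (\<Prod>j\<in>set_mset \<mu>. fact (count \<mu> j)) dvd (fact b :: nat)"
    using card_permutations_of_multiset(2)[of ?A] True by simp
  then obtain q where q: "(fact b :: nat) = fact (b - size \<mu>) * (\<Prod>j\<in>set_mset \<mu>. fact (count \<mu> j)) * q"
    by (rule dvdE)
  let ?ks = "(int b - int (size \<mu>)) # map (\<lambda>j. int (count \<mu> j)) [1..<Suc a]"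
  have "(\<Prod>k\<leftarrow>?ks. fact (nat k) :: nat) = fact (b - size \<mu>) * (\<Prod>j\<leftarrow>[1..<Suc a]. fact (count \<mu> j))"
    using True by (simp add: comp_def nat_diff_distrib' del: upt_Suc)
  also have "(\<Prod>j\<leftarrow>[1..<Suc a]. fact (count \<mu> j) :: nat) = (\<Prod>j\<in>{1..<Suc a}. fact (count \<mu> j))"
    by (subst prod.distinct_set_conv_list[symmetric]) (simp_all del: upt_Suc)
  finally have D: "(\<Prod>k\<leftarrow>?ks. fact (nat k) :: nat) = fact (b - size \<mu>) * (\<Prod>j\<in>set_mset \<mu>. fact (count \<mu> j))"
    unfolding P .
  have "\<not> (\<exists>k\<in>set ?ks. k < 0)" using True by auto
  then have "multinomial b ?ks = q"
    unfolding multinomial_def D q by (simp add: prod_zero_iff)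
  moreover have "(fact b :: complex) = fact (b - size \<mu>) * (\<Prod>j\<in>set_mset \<mu>. fact (count \<mu> j)) * of_nat q"
    using arg_cong[OF q, of "of_nat :: nat \<Rightarrow> complex"] by simp
  ultimately show ?thesis
    using True by (simp add: multinomial_coeff_def)
qed

section \<open>Shapes, horizontal strips and the Cauchy identity\<close>

text \<open>Partitions with infinitely many zero rows appended: interlacing conditions then read the
  same in every row, and a strip may start a new row.\<close>

definition shapes :: "(nat \<Rightarrow> nat) set" where
  "shapes = {l. antimono l \<and> (\<exists>N. \<forall>i\<ge>N. l i = 0)}"

definition shape_size :: "(nat \<Rightarrow> nat) \<Rightarrow> nat" where
  "shape_size l = (\<Sum>i | l i > 0. l i)"

lemma shape_size_eq:
  assumes "\<forall>i\<ge>N. l i = 0"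
  shows "shape_size l = (\<Sum>i<N. l i)"
  unfolding shape_size_def using assms
  by (intro sum.mono_neutral_left) (auto simp: not_less[symmetric])

lemma shapes_bound:
  assumes "l \<in> shapes"
  obtains N where "\<And>i. N \<le> i \<Longrightarrow> l i = 0"
  using assms by (auto simp: shapes_def)

lemma finite_support: "l \<in> shapes \<Longrightarrow> finite {i. 0 < l i}"
  by (rule shapes_bound, assumption)
    (metis (mono_tags, lifting) finite_nat_set_iff_bounded mem_Collect_eq not_less not_less_zero)

lemma shapes_antimono: "l \<in> shapes \<Longrightarrow> i \<le> j \<Longrightarrow> l j \<le> l i"
  by (auto simp: shapes_def antimono_def)

lemma zero_in_shapes [simp]: "(\<lambda>_. 0) \<in> shapes"
  by (simp add: shapes_def)

lemma shape_size_zero [simp]: "shape_size (\<lambda>_. 0) = 0"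
  by (simp add: shape_size_def)

text \<open>The skew shape \<open>l/r\<close> is a horizontal strip.\<close>

definition strip :: "(nat \<Rightarrow> nat) \<Rightarrow> (nat \<Rightarrow> nat) \<Rightarrow> bool" where
  "strip r l \<longleftrightarrow> (\<forall>i. r i \<le> l i \<and> l (Suc i) \<le> r i)"

lemma strip_lower_in_shapes:
  assumes "strip r l" "l \<in> shapes"
  shows "r \<in> shapes"
proof -
  obtain N where N: "\<And>i. N \<le> i \<Longrightarrow> l i = 0" using shapes_bound[OF assms(2)] by blast
  have "antimono r"
    unfolding antimono_iff_le_Suc using assms(1) by (meson strip_def le_trans)
  moreover have "r i = 0" if "N \<le> i" for i
    using assms(1) N[OF that] by (metis strip_def le_zero_eq)
  ultimately show ?thesis by (auto simp: shapes_def)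
qed

lemma strip_upper_in_shapes:
  assumes "strip r l" "r \<in> shapes"
  shows "l \<in> shapes"
proof -
  obtain N where N: "\<And>i. N \<le> i \<Longrightarrow> r i = 0" using shapes_bound[OF assms(2)] by blast
  have "antimono l"
    unfolding antimono_iff_le_Suc using assms(1) by (meson strip_def le_trans)
  \<comment> \<open>A strip can occupy one row more than \<open>r\<close>, hence
    \<open>Suc N\<close>.\<close>
  moreover have "l i = 0" if "Suc N \<le> i" for i
    using assms(1) N[of "i - 1"] that by (cases i) (auto simp: strip_def dest!: spec[of _ "i - 1"])
  ultimately show ?thesis by (auto simp: shapes_def)
qed

lemma shape_size_mono:
  assumes "\<forall>i. r i \<le> l i" "l \<in> shapes"
  shows "shape_size r \<le> shape_size l"
proof -
  obtain N where N: "\<And>i. N \<le> i \<Longrightarrow> l i = 0" using shapes_bound[OF assms(2)] by blast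
  then have "\<forall>i\<ge>N. r i = 0" using assms(1) by (metis le_zero_eq)
  then show ?thesis
    using N assms(1) by (simp add: shape_size_eq[of N] sum_mono)
qed

lemma shape_size_strip: "strip r l \<Longrightarrow> l \<in> shapes \<Longrightarrow> shape_size r \<le> shape_size l"
  by (rule shape_size_mono) (auto simp: strip_def)

section \<open>Finiteness of the index sets\<close>

lemma le_shape_size:
  assumes "l \<in> shapes"
  shows "l i \<le> shape_size l" "shape_size l \<le> i \<Longrightarrow> l i = 0"
proof -
  obtain N where N: "\<And>i. N \<le> i \<Longrightarrow> l i = 0" using shapes_bound[OF assms] by blast
  have S: "shape_size l = (\<Sum>i<N. l i)" using N by (intro shape_size_eq) auto
  show "l i \<le> shape_size l"
  proof (cases "i < N")
    case True
    then show ?thesis unfolding S by (intro member_le_sum) auto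
  qed (use N in simp)
  show "l i = 0" if i: "shape_size l \<le> i"
  proof (rule ccontr)
    assume "l i \<noteq> 0"
    then have "l j \<ge> 1" if "j \<le> i" for j
      using shapes_antimono[OF assms that] by simp
    moreover have "i < N" using N \<open>l i \<noteq> 0\<close> not_less by blast
    ultimately have "(\<Sum>j\<le>i. 1) \<le> (\<Sum>j\<le>i. l j)" "(\<Sum>j\<le>i. l j) \<le> (\<Sum>j<N. l j)"
      using sum_mono[of "{..i}" "\<lambda>_. 1" l] by (auto intro!: sum_mono2)
    then show False using i S by simp
  qed
qed

lemma finite_shapes_shape_size: "finite {l \<in> shapes. shape_size l = n}"
proof (rule finite_subset)
  show "{l \<in> shapes. shape_size l = n}
      \<subseteq> {l. \<forall>i. (i \<in> {..<n} \<longrightarrow> l i \<in> {..n}) \<and> (i \<notin> {..<n} \<longrightarrow> l i = 0)}"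
    using le_shape_size by auto
  show "finite {l. \<forall>i. (i \<in> {..<n} \<longrightarrow> l i \<in> {..n}) \<and> (i \<notin> {..<n} \<longrightarrow> l i = (0::nat))}"
    by (rule finite_set_of_finite_funs) auto
qed

lemma finite_shapes_le: "finite {l \<in> shapes. shape_size l \<le> n}"
proof -
  have "{l \<in> shapes. shape_size l \<le> n} = (\<Union>k\<le>n. {l \<in> shapes. shape_size l = k})" by auto
  then show ?thesis by (simp add: finite_shapes_shape_size)
qed

lemma finite_strip_lower: "l \<in> shapes \<Longrightarrow> finite {r. strip r l \<and> P r}"
  by (rule finite_subset[OF _ finite_shapes_le[of "shape_size l"]])
    (auto intro: strip_lower_in_shapes shape_size_strip)

lemma finite_strip_upper: "l \<in> shapes \<Longrightarrow> finite {v. strip l v \<and> shape_size v = n}"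
  by (rule finite_subset[OF _ finite_shapes_shape_size[of n]]) (auto intro: strip_upper_in_shapes)

text \<open>
  This counts tableaux with entries less than \<open>n\<close>: the entries less than \<open>k\<close>, for
  \<open>k = 0, \<dots>, n\<close>, occupy a chain of shapes in which consecutive ones differ by horizontal strips.
\<close>

fun strip_chains :: "(nat \<Rightarrow> nat \<Rightarrow> bool) \<Rightarrow> nat \<Rightarrow> (nat \<Rightarrow> nat) \<Rightarrow> nat" where
  "strip_chains P 0 l = (if l = (\<lambda>_. 0) then 1 else 0)"
| "strip_chains P (Suc n) l = (\<Sum>r | strip r l \<and> P n (shape_size l - shape_size r). strip_chains P n r)"

abbreviation all_chains :: "nat \<Rightarrow> (nat \<Rightarrow> nat) \<Rightarrow> nat" where
  "all_chains \<equiv> strip_chains (\<lambda>_ _. True)"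

text \<open>Sum \<open>ex\<close> over all rows. Since \<open>min + max = l + m\<close> row by row,
  only boundary terms remain: \<open>v 0\<close> and the maximum in row 0, which the shifted sums
  omit.\<close>

lemma shape_size_exchange:
  assumes "l \<in> shapes" "m \<in> shapes" "r \<in> shapes" "v \<in> shapes"
    and ex: "\<And>i. r i + v (Suc i) = min (l i) (m i) + max (l (Suc i)) (m (Suc i))"
  shows "shape_size v + shape_size r + max (l 0) (m 0) = v 0 + shape_size l + shape_size m"
proof -
  obtain N1 where N1: "\<And>i. N1 \<le> i \<Longrightarrow> l i = 0" using shapes_bound[OF assms(1)] by blast
  obtain N2 where N2: "\<And>i. N2 \<le> i \<Longrightarrow> m i = 0" using shapes_bound[OF assms(2)] by blast
  obtain N3 where N3: "\<And>i. N3 \<le> i \<Longrightarrow> r i = 0" using shapes_bound[OF assms(3)] by blast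
  obtain N4 where N4: "\<And>i. N4 \<le> i \<Longrightarrow> v i = 0" using shapes_bound[OF assms(4)] by blast
  note N = N1 N2 N3 N4
  define N where "N = N1 + N2 + N3 + N4"
  have sz: "shape_size l = (\<Sum>i<N. l i)" "shape_size m = (\<Sum>i<N. m i)" "shape_size r = (\<Sum>i<N. r i)"
    "shape_size v = (\<Sum>i<Suc N. v i)"
    using N by (auto intro!: shape_size_eq simp: N_def)
  have "(\<Sum>i<N. r i) + (\<Sum>i<N. v (Suc i)) = (\<Sum>i<N. min (l i) (m i)) + (\<Sum>i<N. max (l (Suc i)) (m (Suc i)))"
    by (simp add: ex flip: sum.distrib)
  moreover have "(\<Sum>i<Suc N. v i) = v 0 + (\<Sum>i<N. v (Suc i))"
    by (rule sum.lessThan_Suc_shift)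
  moreover have "(\<Sum>i<Suc N. max (l i) (m i)) = max (l 0) (m 0) + (\<Sum>i<N. max (l (Suc i)) (m (Suc i)))"
    by (rule sum.lessThan_Suc_shift)
  moreover have "(\<Sum>i<Suc N. max (l i) (m i)) = (\<Sum>i<N. max (l i) (m i))"
    using N by (simp add: N_def)
  moreover have "(\<Sum>i<N. min (l i) (m i)) + (\<Sum>i<N. max (l i) (m i)) = (\<Sum>i<N. l i) + (\<Sum>i<N. m i)"
    by (simp add: min_def max_def flip: sum.distrib)
      (auto simp: sum.distrib[symmetric] intro!: sum.cong)
  ultimately show ?thesis unfolding sz by linarith
qed

text \<open>
  The local rule of the Robinson-Schensted-Knuth correspondence. Both \<open>v (i + 1)\<close>
  and \<open>r i\<close> range over the interval between \<open>max (l (i + 1)) (m (i + 1))\<close> and \<open>min (l i) (m i)\<close>,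
  so they are exchanged by reflecting this interval; the unconstrained first row of \<open>v\<close> takes up
  the remaining size.
\<close>

lemma card_strip_exchange:
  assumes l: "l \<in> shapes" and m: "m \<in> shapes"
  shows "card {v. strip l v \<and> strip m v \<and> shape_size v = shape_size l + k}
    = card {r. strip r l \<and> strip r m \<and> shape_size m \<le> shape_size r + k}"
proof -
  let ?A = "{v. strip l v \<and> strip m v \<and> shape_size v = shape_size l + k}"
  let ?B = "{r. strip r l \<and> strip r m \<and> shape_size m \<le> shape_size r + k}"
  let ?s = "\<lambda>i. min (l i) (m i) + max (l (Suc i)) (m (Suc i))"
  \<comment> \<open>\<open>?s i\<close> is the sum of the two ends of the interval for row
    \<open>i\<close>, so subtraction from it is the reflection. \<open>?G\<close> rebuilds row 0 of
    \<open>v\<close> from the prescribed size.\<close>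
  let ?F = "\<lambda>v i. ?s i - v (Suc i)"
  let ?G = "\<lambda>r i. case i of 0 \<Rightarrow> max (l 0) (m 0) + (shape_size r + k - shape_size m) | Suc j \<Rightarrow> ?s j - r j"
  have A: "?F v \<in> ?B \<and> ?G (?F v) = v" if v: "v \<in> ?A" for v
  proof -
    have sv: "strip l v" "strip m v" and size: "shape_size v = shape_size l + k" using v by auto
    have vb: "max (l i) (m i) \<le> v i" "v (Suc i) \<le> min (l i) (m i)" for i
      using sv by (auto simp: strip_def)
    have r: "max (l (Suc i)) (m (Suc i)) \<le> ?F v i" "?F v i \<le> min (l i) (m i)" for i
      using vb(1)[of "Suc i"] vb(2)[of i] by linarith+
    then have sr: "strip (?F v) l" "strip (?F v) m"
      unfolding strip_def by (metis max.bounded_iff min.bounded_iff)+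
    have "shape_size v + shape_size (?F v) + max (l 0) (m 0) = v 0 + shape_size l + shape_size m"
    proof (rule shape_size_exchange[OF l m])
      show "?F v \<in> shapes" using strip_lower_in_shapes[OF sr(1) l] .
      show "v \<in> shapes" using strip_upper_in_shapes[OF sv(1) l] .
      show "?F v i + v (Suc i) = ?s i" for i using vb(2)[of i] by linarith
    qed
    then have v0: "shape_size (?F v) + k + max (l 0) (m 0) = v 0 + shape_size m" using size by linarith
    \<comment> \<open>The size bound in \<open>?B\<close> amounts to
      \<open>max (l 0) (m 0) \<le> v 0\<close>; it makes the subtraction in row 0 of
      \<open>?G\<close> exact.\<close>
    then have le: "shape_size m \<le> shape_size (?F v) + k" using vb(1)[of 0] by linarith
    have "?G (?F v) i = v i" for i
    proof (cases i)
      case 0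
      then show ?thesis using v0 le by simp
    next
      case (Suc j)
      have "v (Suc j) \<le> ?s j" using vb(2)[of j] by linarith
      then show ?thesis using Suc by simp
    qed
    with sr le show ?thesis by blast
  qed
  have B: "?G r \<in> ?A \<and> ?F (?G r) = r" if r: "r \<in> ?B" for r
  proof -
    have sr: "strip r l" "strip r m" and le: "shape_size m \<le> shape_size r + k" using r by auto
    have rb: "max (l (Suc i)) (m (Suc i)) \<le> r i" "r i \<le> min (l i) (m i)" for i
      using sr by (auto simp: strip_def)
    have rs: "r i \<le> ?s i" for i using rb(2)[of i] by linarith
    have G: "max (l i) (m i) \<le> ?G r i" "?G r (Suc i) \<le> min (l i) (m i)" for i
    proof -
      have "?s i - r i \<le> min (l i) (m i)" using rb(1)[of i] by linarith
      then show "?G r (Suc i) \<le> min (l i) (m i)" by (simp only: nat.case)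
      show "max (l i) (m i) \<le> ?G r i"
      proof (cases i)
        case (Suc j)
        have "max (l (Suc j)) (m (Suc j)) \<le> ?s j - r j" using rb(2)[of j] by linarith
        then show ?thesis unfolding Suc by (simp only: nat.case)
      qed simp
    qed
    have "strip l (?G r) \<and> strip m (?G r)"
      unfolding strip_def
    proof (intro allI conjI)
      fix i
      show "l i \<le> ?G r i" "m i \<le> ?G r i" using G(1)[of i] by (simp_all only: max.bounded_iff)
      show "?G r (Suc i) \<le> l i" "?G r (Suc i) \<le> m i" using G(2)[of i] by (simp_all only: min.bounded_iff)
    qed
    then have sv: "strip l (?G r)" "strip m (?G r)" by blast+
    have "shape_size (?G r) + shape_size r + max (l 0) (m 0) = ?G r 0 + shape_size l + shape_size m"
    proof (rule shape_size_exchange[OF l m])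
      show "r \<in> shapes" using strip_lower_in_shapes[OF sr(1) l] .
      show "?G r \<in> shapes" using strip_upper_in_shapes[OF sv(1) l] .
      show "r i + ?G r (Suc i) = ?s i" for i
        unfolding nat.case by (rule le_add_diff_inverse[OF rs])
    qed
    moreover have "?G r 0 + shape_size m = max (l 0) (m 0) + (shape_size r + k)" using le by simp
    ultimately have "shape_size (?G r) = shape_size l + k" by linarith
    moreover have "?F (?G r) i = r i" for i
      unfolding nat.case by (rule diff_diff_cancel[OF rs])
    ultimately show ?thesis using sv by blast
  qed
  have "bij_betw ?F ?A ?B"
    by (rule bij_betwI[where g = ?G]) (use A B in blast)+
  then show ?thesis by (rule bij_betw_same_card)
qed

text \<open>The Pieri rule \<open>h\<^sub>k s\<^sub>l = \<Sum> s\<^sub>v\<close>, evaluated at \<open>n\<close> ones.\<close>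

lemma all_chains_Pieri:
  "l \<in> shapes \<Longrightarrow>
    (\<Sum>v | strip l v \<and> shape_size v = shape_size l + k. all_chains n v) = multichoose n k * all_chains n l"
proof (induction n arbitrary: l k)
  case 0
  have "(\<Sum>v | strip l v \<and> shape_size v = shape_size l + k. all_chains 0 v)
      = (\<Sum>v\<in>{v. strip l v \<and> shape_size v = shape_size l + k} \<inter> {\<lambda>_. 0}. 1)"
    using finite_strip_upper[OF 0] by (subst sum.inter_restrict) auto
  also have "{v. strip l v \<and> shape_size v = shape_size l + k} \<inter> {\<lambda>_. 0} = (if l = (\<lambda>_. 0) \<and> k = 0 then {\<lambda>_. 0} else {})"
    by (auto simp: strip_def)
  finally show ?case by (auto simp: multichoose_0_left)
next
  case (Suc n)
  note l = Suc.prems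
  let ?V = "{v. strip l v \<and> shape_size v = shape_size l + k}"
  let ?M = "{m \<in> shapes. shape_size m \<le> shape_size l + k}"
  have V: "v \<in> shapes" if "v \<in> ?V" for v using that strip_upper_in_shapes[OF _ l] by auto
  \<comment> \<open>The largest letter is removed from \<open>v\<close>: \<open>m\<close> is the
    shape of the remaining letters. The bound in \<open>?M\<close> makes the outer index set
    independent of \<open>v\<close>, so that the sums can be exchanged.\<close>
  have "(\<Sum>v\<in>?V. all_chains (Suc n) v) = (\<Sum>v\<in>?V. \<Sum>m | m \<in> ?M \<and> strip m v. all_chains n m)"
  proof (rule sum.cong[OF refl])
    fix v assume v: "v \<in> ?V"
    have "{m. strip m v} = {m. m \<in> ?M \<and> strip m v}"
      using v strip_lower_in_shapes[OF _ V[OF v]] shape_size_strip[OF _ V[OF v]] by auto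
    then show "all_chains (Suc n) v = (\<Sum>m | m \<in> ?M \<and> strip m v. all_chains n m)" by simp
  qed
  also have "\<dots> = (\<Sum>m\<in>?M. \<Sum>v | v \<in> ?V \<and> strip m v. all_chains n m)"
    by (rule sum.swap_restrict[OF finite_strip_upper[OF l] finite_shapes_le])
  also have "\<dots> = (\<Sum>m\<in>?M. card {r. strip r l \<and> strip r m \<and> shape_size m \<le> shape_size r + k} * all_chains n m)"
  proof (rule sum.cong[OF refl])
    fix m assume m: "m \<in> ?M"
    have "{v. v \<in> ?V \<and> strip m v} = {v. strip l v \<and> strip m v \<and> shape_size v = shape_size l + k}" by auto
    then show "(\<Sum>v | v \<in> ?V \<and> strip m v. all_chains n m)
        = card {r. strip r l \<and> strip r m \<and> shape_size m \<le> shape_size r + k} * all_chains n m"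
      using card_strip_exchange[OF l, of m k] m by simp
  qed
  also have "\<dots> = (\<Sum>m\<in>?M. \<Sum>r | r \<in> {r. strip r l} \<and> (strip r m \<and> shape_size m \<le> shape_size r + k). all_chains n m)"
    by simp
  also have "\<dots> = (\<Sum>r | strip r l. \<Sum>m | m \<in> ?M \<and> (strip r m \<and> shape_size m \<le> shape_size r + k). all_chains n m)"
    by (rule sum.swap_restrict[OF finite_shapes_le]) (use finite_strip_lower[OF l, of "\<lambda>_. True"] in simp)
  also have "\<dots> = (\<Sum>r | strip r l. multichoose (Suc n) k * all_chains n r)"
  proof (rule sum.cong[OF refl])
    fix r assume "r \<in> {r. strip r l}"
    then have r: "r \<in> shapes" "shape_size r \<le> shape_size l"
      using strip_lower_in_shapes[OF _ l] shape_size_strip[OF _ l] by auto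
    let ?W = "{m. strip r m \<and> shape_size m \<le> shape_size r + k}"
    have W: "m \<in> shapes \<and> shape_size r \<le> shape_size m" if "m \<in> ?W" for m
      using that strip_upper_in_shapes[OF _ r(1)] shape_size_strip[of r m] by auto
    then have fin: "finite ?W"
      by (intro finite_subset[OF _ finite_shapes_le[of "shape_size r + k"]]) auto
    have "{m. m \<in> ?M \<and> (strip r m \<and> shape_size m \<le> shape_size r + k)} = ?W"
      using W r(2) by force
    then have "(\<Sum>m | m \<in> ?M \<and> (strip r m \<and> shape_size m \<le> shape_size r + k). all_chains n m)
        = (\<Sum>m\<in>?W. all_chains n m)" by simp
    \<comment> \<open>Each \<open>m\<close> extends \<open>r\<close> by a strip of some size
      \<open>j \<le> k\<close>; the induction hypothesis for \<open>r\<close> evaluates each size,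
      and the partial sums of \<open>multichoose_Suc\<close> account for the removed letter.\<close>
    also have "\<dots> = (\<Sum>j\<le>k. \<Sum>m | m \<in> ?W \<and> shape_size m - shape_size r = j. all_chains n m)"
      by (rule sum.group[symmetric, OF fin]) auto
    also have "\<dots> = (\<Sum>j\<le>k. multichoose n j * all_chains n r)"
    proof (rule sum.cong[OF refl])
      fix j assume "j \<in> {..k}"
      then have "{m. m \<in> ?W \<and> shape_size m - shape_size r = j} = {m. strip r m \<and> shape_size m = shape_size r + j}"
        using W by force
      then show "(\<Sum>m | m \<in> ?W \<and> shape_size m - shape_size r = j. all_chains n m) = multichoose n j * all_chains n r"
        using Suc.IH[OF r(1), of j] by simp
    qed
    finally show "(\<Sum>m | m \<in> ?M \<and> (strip r m \<and> shape_size m \<le> shape_size r + k). all_chains n m)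
        = multichoose (Suc n) k * all_chains n r"
      by (simp add: multichoose_Suc sum_distrib_right)
  qed
  finally show ?case by (simp add: sum_distrib_left)
qed

section \<open>The Cauchy identity, one monomial at a time\<close>

lemma chains_content_eq_0:
  "l \<in> shapes \<Longrightarrow> shape_size l \<noteq> (\<Sum>i<n. c i) \<Longrightarrow> strip_chains (\<lambda>i k. k = c i) n l = 0"
proof (induction n arbitrary: l)
  case (Suc n)
  have "strip_chains (\<lambda>i k. k = c i) n r = 0" if "strip r l \<and> shape_size l - shape_size r = c n" for r
    using that Suc.prems shape_size_strip[of r l] by (intro Suc.IH strip_lower_in_shapes[of r l]) auto
  then show ?case by simp
qed auto

text \<open>The two factors are the Kostka number of shape \<open>l\<close> and content
  \<open>c\<close>, and \<open>s_l(1^b)\<close>. Peeling the last letter off the first factor and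
  exchanging the sums leaves, over each \<open>r\<close>, a sum of \<open>all_chains b l\<close>
  that the Pieri rule evaluates.\<close>

lemma sum_chains_all_chains:
  "(\<Sum>l | l \<in> shapes \<and> shape_size l = (\<Sum>i<n. c i). strip_chains (\<lambda>i k. k = c i) n l * all_chains b l)
    = (\<Prod>i<n. multichoose b (c i))"
proof (induction n)
  case 0
  have "shape_size l = 0 \<and> l \<in> shapes \<longleftrightarrow> l = (\<lambda>_. 0)" for l
    using le_shape_size(2)[of l] by auto
  then have "{l. l \<in> shapes \<and> shape_size l = 0} = {\<lambda>_. 0}" by auto
  moreover have "all_chains b (\<lambda>_. 0) = 1"
  proof (induction b)
    case (Suc b)
    have "{r. strip r (\<lambda>_. 0)} = {\<lambda>_. 0}" by (auto simp: strip_def)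
    then show ?case using Suc by simp
  qed simp
  ultimately show ?case by simp
next
  case (Suc n)
  let ?K = "strip_chains (\<lambda>i k. k = c i)"
  let ?L = "{l. l \<in> shapes \<and> shape_size l = (\<Sum>i<Suc n. c i)}"
  let ?R = "{r. r \<in> shapes \<and> shape_size r = (\<Sum>i<n. c i)}"
  have fin: "finite ?L" "finite ?R" by (rule finite_shapes_shape_size)+
  have "(\<Sum>l\<in>?L. ?K (Suc n) l * all_chains b l)
      = (\<Sum>l\<in>?L. \<Sum>r | r \<in> ?R \<and> strip r l. ?K n r * all_chains b l)"
  proof (rule sum.cong[OF refl])
    fix l assume l: "l \<in> ?L"
    have "{r. strip r l \<and> shape_size l - shape_size r = c n} = {r. r \<in> ?R \<and> strip r l}"
      using l strip_lower_in_shapes shape_size_strip by force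
    then show "?K (Suc n) l * all_chains b l = (\<Sum>r | r \<in> ?R \<and> strip r l. ?K n r * all_chains b l)"
      by (simp add: sum_distrib_right)
  qed
  also have "\<dots> = (\<Sum>r\<in>?R. \<Sum>l | l \<in> ?L \<and> strip r l. ?K n r * all_chains b l)"
    by (rule sum.swap_restrict[OF fin])
  also have "\<dots> = (\<Sum>r\<in>?R. multichoose b (c n) * (?K n r * all_chains b r))"
  proof (rule sum.cong[OF refl])
    fix r assume r: "r \<in> ?R"
    have "{l. l \<in> ?L \<and> strip r l} = {l. strip r l \<and> shape_size l = shape_size r + c n}"
      using r strip_upper_in_shapes by auto
    then show "(\<Sum>l | l \<in> ?L \<and> strip r l. ?K n r * all_chains b l)
        = multichoose b (c n) * (?K n r * all_chains b r)"
      using all_chains_Pieri[of r b "c n"] r by (simp add: sum_distrib_left[symmetric])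
  qed
  also have "\<dots> = (\<Prod>i<Suc n. multichoose b (c i))"
    using Suc.IH by (simp add: sum_distrib_left[symmetric])
  finally show ?case .
qed

section \<open>Tableaux as chains of horizontal strips\<close>

definition cells :: "(nat \<Rightarrow> nat) \<Rightarrow> (nat \<times> nat) set" where
  "cells l = {(i, j). j < l i}"

lemma cells_eq_Sigma:
  assumes "\<And>i. N \<le> i \<Longrightarrow> l i = 0"
  shows "cells l = Sigma {..<N} (\<lambda>i. {..<l i})"
  using assms by (auto simp: cells_def) (metis not_less not_less_zero)

lemma finite_cells: "l \<in> shapes \<Longrightarrow> finite (cells l)"
  using cells_eq_Sigma by (metis shapes_bound finite_SigmaI finite_lessThan)

lemma card_cells: "l \<in> shapes \<Longrightarrow> card (cells l) = shape_size l"
proof -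
  assume l: "l \<in> shapes"
  obtain N where N: "\<And>i. N \<le> i \<Longrightarrow> l i = 0" using shapes_bound[OF l] by blast
  show ?thesis
    using N shape_size_eq[of N l] by (simp add: cells_eq_Sigma[of N])
qed

text \<open>Membership is asked only of the cell further right or further down: in a shape the other
  cell is then present too.\<close>

definition tableaux :: "nat \<Rightarrow> (nat \<Rightarrow> nat) \<Rightarrow> (nat \<times> nat \<Rightarrow> nat) set" where
  "tableaux n l = {T \<in> cells l \<rightarrow>\<^sub>E {..<n}.
     (\<forall>i j j'. (i, j') \<in> cells l \<and> j < j' \<longrightarrow> T (i, j) \<le> T (i, j')) \<and>
     (\<forall>i i' j. (i', j) \<in> cells l \<and> i < i' \<longrightarrow> T (i, j) < T (i', j))}"

lemma finite_tableaux: "l \<in> shapes \<Longrightarrow> finite (tableaux n l)"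
  by (rule finite_subset[of _ "cells l \<rightarrow>\<^sub>E {..<n}"])
    (auto simp: tableaux_def intro: finite_PiE finite_cells)

definition trim :: "nat \<Rightarrow> (nat \<Rightarrow> nat) \<Rightarrow> (nat \<times> nat \<Rightarrow> nat) \<Rightarrow> nat \<Rightarrow> nat" where
  "trim n l T i = card {j. j < l i \<and> T (i, j) < n}"

lemma down_closed_nat_eq_lessThan:
  fixes S :: "nat set"
  assumes "finite S" and down: "\<And>i j. j \<in> S \<Longrightarrow> i < j \<Longrightarrow> i \<in> S"
  shows "S = {..<card S}"
proof (cases "S = {}")
  case False
  have "S = {..<Suc (Max S)}"
  proof (intro equalityI subsetI)
    fix i assume "i \<in> {..<Suc (Max S)}"
    then have "i = Max S \<or> i < Max S" by auto
    then show "i \<in> S" using down[OF Max_in[OF assms(1) False]] Max_in[OF assms(1) False] by metis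
  qed (use Max_ge[OF assms(1)] in \<open>auto simp: less_Suc_eq_le\<close>)
  then show ?thesis by (metis card_lessThan)
qed simp

text \<open>Rows increase weakly, so the entries below \<open>n\<close> form an initial segment of
  each row, and its length describes it completely.\<close>

lemma cells_trim:
  assumes "T \<in> tableaux N l"
  shows "cells (trim n l T) = {d \<in> cells l. T d < n}"
proof -
  have "{j. j < l i \<and> T (i, j) < n} = {..<trim n l T i}" for i
  proof -
    let ?S = "{j. j < l i \<and> T (i, j) < n}"
    have down: "j \<in> ?S" if "j' \<in> ?S" "j < j'" for j j'
    proof -
      have "T (i, j) \<le> T (i, j')" using assms that by (auto simp: tableaux_def cells_def)
      then show ?thesis using that by auto
    qed
    show ?thesis
      unfolding trim_def using down by (intro down_closed_nat_eq_lessThan) simp_all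
  qed
  then show ?thesis by (auto simp: cells_def set_eq_iff)
qed

text \<open>Deleting the entries \<open>n\<close> leaves a tableau with entries below
  \<open>n\<close>, and the deleted cells form a horizontal strip because no column contains
  \<open>n\<close> twice. Keeping \<open>P\<close> arbitrary lets one bijection count both the
  tableaux of a given content and all tableaux.\<close>

lemma card_tableaux_content:
  "l \<in> shapes \<Longrightarrow>
    card {T \<in> tableaux n l. \<forall>i<n. P i (card {d \<in> cells l. T d = i})} = strip_chains P n l"
proof (induction n arbitrary: l)
  case 0
  \<comment> \<open>On an empty set of cells, \<open>PiE\<close> contains exactly the everywhere
    undefined function.\<close>
  have "{T \<in> tableaux 0 l. \<forall>i<0. P i (card {d \<in> cells l. T d = i})} = (if l = (\<lambda>_. 0) then {\<lambda>_. undefined} else {})"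
  proof (cases "l = (\<lambda>_. 0)")
    case True
    then show ?thesis by (auto simp: tableaux_def cells_def PiE_def)
  next
    case False
    then obtain i where "l i \<noteq> 0" by auto
    then have "(i, 0) \<in> cells l" by (simp add: cells_def)
    then show ?thesis using False by (auto simp: tableaux_def)
  qed
  then show ?case by simp
next
  case (Suc n)
  note l = Suc.prems
  let ?X = "{T \<in> tableaux (Suc n) l. \<forall>i<Suc n. P i (card {d \<in> cells l. T d = i})}"
  let ?R = "{r. strip r l \<and> P n (shape_size l - shape_size r)}"
  let ?Y = "\<lambda>r. {T \<in> tableaux n r. \<forall>i<n. P i (card {d \<in> cells r. T d = i})}"
  let ?F = "\<lambda>T. (trim n l T, restrict T (cells (trim n l T)))"
  let ?G = "\<lambda>(r, T). \<lambda>d\<in>cells l. if d \<in> cells r then T d else n"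
  have l_mono: "l i' \<le> l i" if "i \<le> i'" for i i' using shapes_antimono[OF l that] .
  have sub: "cells r \<subseteq> cells l" if "strip r l" for r
    using that by (auto simp: cells_def strip_def intro: less_le_trans)
  have diff: "card (cells l - cells r) = shape_size l - shape_size r" if "strip r l" for r
    using sub[OF that] strip_lower_in_shapes[OF that l] l
    by (simp add: card_Diff_subset finite_cells card_cells)
  have F: "?F T \<in> Sigma ?R ?Y \<and> ?G (?F T) = T" if T: "T \<in> ?X" for T
  proof -
    let ?r = "trim n l T"
    have tab: "T \<in> tableaux (Suc n) l" and P: "\<And>i. i < Suc n \<Longrightarrow> P i (card {d \<in> cells l. T d = i})"
      using T by auto
    note dr = cells_trim[OF tab, of n]
    have "T \<in> cells l \<rightarrow>\<^sub>E {..<Suc n}" using tab by (simp add: tableaux_def)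
    then have bound: "T d < n \<or> T d = n" if "d \<in> cells l" for d
      using that by (metis PiE_mem lessThan_iff less_antisym)
    have strip: "strip ?r l"
      unfolding strip_def
    proof (intro allI conjI)
      fix i
      have "card {j. j < l i \<and> T (i, j) < n} \<le> card {..<l i}" by (rule card_mono) auto
      then show "?r i \<le> l i" by (simp add: trim_def)
      \<comment> \<open>Otherwise the cell \<open>(Suc i, ?r i)\<close> lies directly below an entry
        \<open>n\<close>, and its own entry would exceed \<open>n\<close>.\<close>
      show "l (Suc i) \<le> ?r i"
      proof (rule ccontr)
        assume "\<not> l (Suc i) \<le> ?r i"
        then have d: "(Suc i, ?r i) \<in> cells l" "(i, ?r i) \<notin> cells ?r" by (auto simp: cells_def)
        then have "T (i, ?r i) < T (Suc i, ?r i)" using tab by (auto simp: tableaux_def)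
        moreover have "(i, ?r i) \<in> cells l" using d(1) l_mono[of i "Suc i"] by (auto simp: cells_def)
        ultimately show False using bound[OF d(1)] d(2) unfolding dr by auto
      qed
    qed
    have "{d \<in> cells l. T d = n} = cells l - cells ?r" unfolding dr using bound by auto
    then have Q1: "P n (shape_size l - shape_size ?r)" using P[of n] diff[OF strip] by simp
    have Q2: "restrict T (cells ?r) \<in> tableaux n ?r"
    proof -
      have r_sh: "?r \<in> shapes" using strip_lower_in_shapes[OF strip l] .
      have left: "(i, j) \<in> cells ?r" if "(i, j') \<in> cells ?r" "j < j'" for i j j'
        using that by (auto simp: cells_def)
      have up: "(i, j) \<in> cells ?r" if "(i', j) \<in> cells ?r" "i < i'" for i i' j
        using that shapes_antimono[OF r_sh, of i i'] by (auto simp: cells_def)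
      have "T d < n" if "d \<in> cells ?r" for d using that unfolding dr by auto
      then have R1: "restrict T (cells ?r) \<in> cells ?r \<rightarrow>\<^sub>E {..<n}" by (intro restrict_PiE_iff[THEN iffD2] ballI) simp
      have R2: "T (i, j) \<le> T (i, j')" if "(i, j') \<in> cells ?r" "j < j'" for i j j'
        using tab sub[OF strip] that unfolding tableaux_def by blast
      have R3: "T (i, j) < T (i', j)" if "(i', j) \<in> cells ?r" "i < i'" for i i' j
        using tab sub[OF strip] that unfolding tableaux_def by blast
      show ?thesis
        unfolding tableaux_def
      proof (intro CollectI conjI allI impI)
        fix i j j' assume h: "(i, j') \<in> cells ?r \<and> j < j'"
        then have "(i, j) \<in> cells ?r" using left by blast
        then show "restrict T (cells ?r) (i, j) \<le> restrict T (cells ?r) (i, j')"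
          using R2[of i j' j] h by (simp only: restrict_apply if_True)
      next
        fix i i' j assume h: "(i', j) \<in> cells ?r \<and> i < i'"
        then have "(i, j) \<in> cells ?r" using up by blast
        then show "restrict T (cells ?r) (i, j) < restrict T (cells ?r) (i', j)"
          using R3[of i' j i] h by (simp only: restrict_apply if_True)
      qed (rule R1)
    qed
    have Q3: "P i (card {d \<in> cells ?r. restrict T (cells ?r) d = i})" if "i < n" for i
    proof -
      have "{d \<in> cells ?r. restrict T (cells ?r) d = i} = {d \<in> cells l. T d = i}"
        unfolding dr using that by auto
      then show ?thesis using P[of i] that by simp
    qed
    have Q4: "?G (?F T) = T"
    proof (rule ext)
      fix d
      have "T d = undefined" if "d \<notin> cells l"
        using tab that by (auto simp: tableaux_def intro: PiE_arb)
      moreover have "?G (?F T) d = (if d \<in> cells l then if d \<in> cells ?r then T d else n else undefined)"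
        by simp
      moreover have "d \<in> cells l \<Longrightarrow> d \<notin> cells ?r \<Longrightarrow> T d = n" using bound[of d] unfolding dr by blast
      ultimately show "?G (?F T) d = T d" by presburger
    qed
    have "?F T \<in> Sigma ?R ?Y"
      by (intro SigmaI CollectI conjI allI impI strip Q1 Q2 Q3)
    with Q4 show ?thesis by (intro conjI)
  qed
  have G: "?G x \<in> ?X \<and> ?F (?G x) = x" if x: "x \<in> Sigma ?R ?Y" for x
  proof -
    obtain r T where xrT: "x = (r, T)" by force
    have strip: "strip r l" and Pn: "P n (shape_size l - shape_size r)" and tab: "T \<in> tableaux n r"
      and P: "\<And>i. i < n \<Longrightarrow> P i (card {d \<in> cells r. T d = i})"
      using x xrT by auto
    have Tn: "T d < n" if "d \<in> cells r" for d using tab that by (auto simp: tableaux_def)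
    define U where "U = ?G x"
    have U: "U d = (if d \<in> cells r then T d else n)" if "d \<in> cells l" for d
      using that by (simp add: U_def xrT)
    have Ur: "U d = T d" if "d \<in> cells r" for d using U[of d] that sub[OF strip] by auto
    have U_lt: "U d < n \<longleftrightarrow> d \<in> cells r" if "d \<in> cells l" for d
      using U[OF that] Tn[of d] by auto
    have U_le: "U d \<le> n" if "d \<in> cells l" for d
      using U[OF that] Tn[of d] by (auto intro: less_imp_le)
    have l_left: "(i, j) \<in> cells l" if "(i, j') \<in> cells l" "j < j'" for i j j'
      using that by (auto simp: cells_def)
    have r_left: "(i, j) \<in> cells r" if "(i, j') \<in> cells r" "j < j'" for i j j'
      using that by (auto simp: cells_def)
    \<comment> \<open>Since \<open>l\<close> exceeds \<open>r\<close> by a horizontal strip, every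
      cell above another cell of \<open>l\<close> lies in \<open>r\<close>; hence the entries
      \<open>n\<close> filled in by \<open>?G\<close> keep the columns strict.\<close>
    have r_up: "(i, j) \<in> cells r" if "(i', j) \<in> cells l" "i < i'" for i i' j
    proof -
      have "l i' \<le> l (Suc i)" using that by (intro l_mono) simp
      also have "\<dots> \<le> r i" using strip by (simp add: strip_def)
      finally show ?thesis using that by (auto simp: cells_def)
    qed
    have "U \<in> tableaux (Suc n) l"
      unfolding tableaux_def
    proof (intro CollectI conjI allI impI, goal_cases)
      case 1
      have "U \<in> extensional (cells l)" by (simp add: U_def xrT)
      then show ?case using U_le by (auto simp: PiE_iff less_Suc_eq_le)
    next
      case (2 i j j')
      then have d: "(i, j') \<in> cells l" "(i, j) \<in> cells l" using l_left by auto
      show ?case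
      proof (cases "(i, j') \<in> cells r")
        case True
        then have "T (i, j) \<le> T (i, j')" using tab 2 by (auto simp: tableaux_def)
        then show ?thesis using Ur True r_left[OF True] 2 by simp
      next
        case False
        then show ?thesis using U[OF d(1)] U_le[OF d(2)] by simp
      qed
    next
      case (3 i i' j)
      then have d: "(i, j) \<in> cells r" using r_up by blast
      show ?case
      proof (cases "(i', j) \<in> cells r")
        case True
        then have "T (i, j) < T (i', j)" using tab 3 by (auto simp: tableaux_def)
        then show ?thesis using Ur True d by simp
      next
        case False
        then show ?thesis using 3 U[of "(i', j)"] Ur[OF d] Tn[OF d] by simp
      qed
    qed
    moreover have "P i (card {d \<in> cells l. U d = i})" if "i < Suc n" for i
    proof (cases "i = n")
      case True
      have "U d = n \<longleftrightarrow> d \<notin> cells r" if "d \<in> cells l" for d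
        using U[OF that] Tn[of d] by auto
      then have "{d \<in> cells l. U d = n} = cells l - cells r" by auto
      then show ?thesis using True Pn diff[OF strip] by simp
    next
      case False
      then have "{d \<in> cells l. U d = i} = {d \<in> cells r. T d = i}"
        using U sub[OF strip] by (auto split: if_splits)
      then show ?thesis using False that P[of i] by simp
    qed
    moreover have tr: "trim n l U = r"
    proof
      fix i
      have "{j. j < l i \<and> U (i, j) < n} = {..<r i}"
      proof -
        have "j < l i \<and> U (i, j) < n \<longleftrightarrow> j < r i" for j
          using U_lt[of "(i, j)"] strip by (auto simp: cells_def strip_def intro: less_le_trans)
        then show ?thesis by auto
      qed
      then show "trim n l U i = r i" by (simp add: trim_def)
    qed
    moreover have "restrict U (cells r) = T"
    proof (rule ext)
      fix d
      have "T d = undefined" if "d \<notin> cells r"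
        using tab that by (auto simp: tableaux_def intro: PiE_arb)
      then show "restrict U (cells r) d = T d" using Ur[of d] by (cases "d \<in> cells r") auto
    qed
    ultimately show ?thesis unfolding U_def[symmetric] by (simp add: xrT)
  qed
  have "bij_betw ?F ?X (Sigma ?R ?Y)"
    by (rule bij_betwI[where g = ?G]) (use F G in blast)+
  then have "card ?X = card (Sigma ?R ?Y)" by (rule bij_betw_same_card)
  also have "\<dots> = (\<Sum>r\<in>?R. card (?Y r))"
  proof (rule card_SigmaI)
    show "finite ?R" by (rule finite_strip_lower[OF l])
    show "\<forall>r\<in>?R. finite (?Y r)"
    proof
      fix r assume "r \<in> ?R"
      then have "finite (tableaux n r)" using strip_lower_in_shapes[OF _ l] finite_tableaux by blast
      then show "finite (?Y r)" by (rule rev_finite_subset) blast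
    qed
  qed
  also have "\<dots> = (\<Sum>r\<in>?R. strip_chains P n r)"
    using Suc.IH strip_lower_in_shapes[OF _ l] by (intro sum.cong refl) auto
  finally show ?case by simp
qed

section \<open>Partitions as shapes, and Schur functions as counts of chains\<close>

definition rows :: "nat multiset \<Rightarrow> nat \<Rightarrow> nat" where
  "rows \<mu> i = (if i < size \<mu> then rev (sorted_list_of_multiset \<mu>) ! i else 0)"

lemma diagram_eq_cells: "diagram \<mu> = cells (rows \<mu>)"
  by (auto simp: diagram_def cells_def rows_def split: if_splits)

lemma length_sorted_list_of_multiset [simp]: "length (sorted_list_of_multiset \<mu>) = size \<mu>"
  by (metis mset_sorted_list_of_multiset size_mset)

lemma rows_in_shapes: "rows \<mu> \<in> shapes"
proof -
  let ?xs = "rev (sorted_list_of_multiset \<mu>)"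
  have "sorted_wrt (\<ge>) ?xs"
    by (simp add: sorted_wrt_rev)
  then have "?xs ! j \<le> ?xs ! i" if "i \<le> j" "j < size \<mu>" for i j
    using that by (cases "i = j") (auto simp: sorted_wrt_iff_nth_less)
  then have "antimono (rows \<mu>)" by (auto simp: antimono_def rows_def)
  then show ?thesis by (auto simp: shapes_def rows_def intro!: exI[of _ "size \<mu>"])
qed

lemma mset_nth: "mset xs = image_mset (\<lambda>i. xs ! i) (mset_set {..<length xs})"
  by (metis map_nth mset_map mset_upt lessThan_atLeast0)

lemma shape_size_rows: "shape_size (rows \<mu>) = sum_mset \<mu>"
proof -
  let ?xs = "rev (sorted_list_of_multiset \<mu>)"
  have "shape_size (rows \<mu>) = (\<Sum>i<size \<mu>. rows \<mu> i)"
    by (rule shape_size_eq) (simp add: rows_def)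
  also have "\<dots> = (\<Sum>i<length ?xs. ?xs ! i)" by (simp add: rows_def)
  also have "\<dots> = sum_list ?xs" by (simp add: sum_list_sum_nth lessThan_atLeast0)
  also have "\<dots> = sum_mset \<mu>" by (metis mset_rev mset_sorted_list_of_multiset sum_mset_sum_list)
  finally show ?thesis .
qed

text \<open>Parts are positive, so dropping the zero rows of a shape recovers exactly the
  parts.\<close>

lemma bij_betw_rows: "bij_betw rows (partitions n) {l \<in> shapes. shape_size l = n}"
proof (rule bij_betwI[where g = "\<lambda>l. image_mset l (mset_set {i. l i > 0})"])
  show "rows \<in> partitions n \<rightarrow> {l \<in> shapes. shape_size l = n}"
    by (auto simp: rows_in_shapes shape_size_rows partitions_def)
  show "(\<lambda>l. image_mset l (mset_set {i. l i > 0})) \<in> {l \<in> shapes. shape_size l = n} \<rightarrow> partitions n"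
    by (auto simp: partitions_def shape_size_def sum_unfold_sum_mset finite_support)
  show "image_mset (rows \<mu>) (mset_set {i. rows \<mu> i > 0}) = \<mu>" if "\<mu> \<in> partitions n" for \<mu>
  proof -
    let ?xs = "rev (sorted_list_of_multiset \<mu>)"
    have "?xs ! i > 0" if "i < size \<mu>" for i
    proof -
      have "?xs ! i \<in> set ?xs" using that by (intro nth_mem) simp
      then show ?thesis using \<open>\<mu> \<in> partitions n\<close> by (auto simp: partitions_def intro!: Nat.gr0I)
    qed
    then have "{i. rows \<mu> i > 0} = {..<length ?xs}" by (auto simp: rows_def)
    then have "image_mset (rows \<mu>) (mset_set {i. rows \<mu> i > 0})
        = image_mset (rows \<mu>) (mset_set {..<length ?xs})" by (rule arg_cong)
    also have "\<dots> = image_mset (\<lambda>i. ?xs ! i) (mset_set {..<length ?xs})"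
      by (rule image_mset_cong) (simp add: rows_def)
    also have "\<dots> = mset ?xs" by (rule mset_nth[symmetric])
    finally show ?thesis by simp
  qed
  show "rows (image_mset l (mset_set {i. l i > 0})) = l" if "l \<in> {l \<in> shapes. shape_size l = n}" for l
  proof -
    have l: "l \<in> shapes" using that by simp
    \<comment> \<open>By monotonicity the index of the first zero row is the number of nonzero
      rows.\<close>
    define N where "N = (LEAST N. l N = 0)"
    obtain N' where "l N' = 0" using shapes_bound[OF l] by blast
    then have "l N = 0" unfolding N_def by (rule LeastI)
    have pos: "l i > 0 \<longleftrightarrow> i < N" for i
    proof (cases "i < N")
      case True
      then show ?thesis using not_less_Least[of i "\<lambda>N. l N = 0"] by (simp add: N_def)
    next
      case False
      then show ?thesis using shapes_antimono[OF l, of N i] \<open>l N = 0\<close> by simp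
    qed
    then have "image_mset l (mset_set {i. l i > 0}) = mset (rev (map l [0..<N]))"
      by (simp add: lessThan_atLeast0 lessThan_def[symmetric])
    moreover have "sorted (rev (map l [0..<N]))"
      unfolding sorted_wrt_rev sorted_wrt_map
      using shapes_antimono[OF l] by (auto simp: sorted_wrt_iff_nth_less)
    ultimately have "sorted_list_of_multiset (image_mset l (mset_set {i. l i > 0})) = rev (map l [0..<N])"
      by (simp add: sorted_sort_id del: mset_rev)
    moreover have "size (image_mset l (mset_set {i. l i > 0})) = N"
      by (simp add: pos)
    ultimately show ?thesis
      using pos by (auto simp: rows_def fun_eq_iff)
  qed
qed

lemma semistandard_bounded_eq_tableaux:
  "{T \<in> semistandard \<mu>. \<forall>d\<in>diagram \<mu>. T d < n} = tableaux n (rows \<mu>)"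
proof -
  have left: "(i, j) \<in> cells (rows \<mu>)" if "(i, j') \<in> cells (rows \<mu>)" "j < j'" for i j j'
    using that by (auto simp: cells_def)
  have up: "(i, j) \<in> cells (rows \<mu>)" if "(i', j) \<in> cells (rows \<mu>)" "i < i'" for i i' j
    using that shapes_antimono[OF rows_in_shapes, of i i' \<mu>] by (auto simp: cells_def)
  show ?thesis
  proof (intro set_eqI iffI)
    fix T assume T: "T \<in> {T \<in> semistandard \<mu>. \<forall>d\<in>diagram \<mu>. T d < n}"
    show "T \<in> tableaux n (rows \<mu>)"
      unfolding tableaux_def
    proof (intro CollectI conjI allI impI)
      show "T \<in> cells (rows \<mu>) \<rightarrow>\<^sub>E {..<n}"
        using T unfolding semistandard_def diagram_eq_cells PiE_iff by blast
      show "T (i, j) \<le> T (i, j')" if "(i, j') \<in> cells (rows \<mu>) \<and> j < j'" for i j j'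
        using T that left[of i j' j] unfolding semistandard_def diagram_eq_cells by blast
      show "T (i, j) < T (i', j)" if "(i', j) \<in> cells (rows \<mu>) \<and> i < i'" for i i' j
        using T that up[of i' j i] unfolding semistandard_def diagram_eq_cells by blast
    qed
  next
    fix T assume T: "T \<in> tableaux n (rows \<mu>)"
    show "T \<in> {T \<in> semistandard \<mu>. \<forall>d\<in>diagram \<mu>. T d < n}"
      unfolding semistandard_def diagram_eq_cells
    proof (intro CollectI conjI allI impI ballI)
      show "T \<in> extensional (cells (rows \<mu>))" "\<And>d. d \<in> cells (rows \<mu>) \<Longrightarrow> T d < n"
        using T by (auto simp: tableaux_def PiE_iff)
    qed (use T in \<open>simp_all add: tableaux_def\<close>)
  qed
qed

lemma finite_diagram: "finite (diagram \<mu>)"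
  by (simp add: diagram_eq_cells finite_cells rows_in_shapes)

lemma count_content: "count (content \<mu> T) i = card {d \<in> diagram \<mu>. T d = i}"
proof -
  have "{d \<in> diagram \<mu>. T d = i} = T -` {i} \<inter> diagram \<mu>" by auto
  then show ?thesis
    by (simp add: content_def count_image_mset finite_diagram)
qed

lemma set_content: "set_mset (content \<mu> T) = T ` diagram \<mu>"
  by (simp add: content_def finite_diagram)

text \<open>A tableau of content \<open>m\<close> has entries below any bound \<open>N\<close> for
  the variables of \<open>m\<close>, so the coefficient, a Kostka number, becomes a count of chains
  of length \<open>N\<close>; variables absent from \<open>m\<close> give empty strips.\<close>

lemma coeff_s_fun:
  assumes "set_mset m \<subseteq> {..<N}"
  shows "coeff (s_fun \<mu>) m = of_nat (strip_chains (\<lambda>i k. k = count m i) N (rows \<mu>))"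
proof -
  have "content \<mu> T = m \<longleftrightarrow> (\<forall>d\<in>diagram \<mu>. T d < N) \<and> (\<forall>i<N. card {d \<in> diagram \<mu>. T d = i} = count m i)" for T
  proof
    assume "content \<mu> T = m"
    then show "(\<forall>d\<in>diagram \<mu>. T d < N) \<and> (\<forall>i<N. card {d \<in> diagram \<mu>. T d = i} = count m i)"
      using assms set_content[of \<mu> T] by (auto simp flip: count_content)
  next
    assume R: "(\<forall>d\<in>diagram \<mu>. T d < N) \<and> (\<forall>i<N. card {d \<in> diagram \<mu>. T d = i} = count m i)"
    show "content \<mu> T = m"
    proof (rule multiset_eqI)
      fix i
      show "count (content \<mu> T) i = count m i"
      proof (cases "i < N")
        case True
        then show ?thesis using R by (simp add: count_content)
      next
        case False
        then have empty: "{d \<in> diagram \<mu>. T d = i} = {}" and "i \<notin># m" using R assms by auto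
        then show ?thesis unfolding count_content empty by (simp add: not_in_iff)
      qed
    qed
  qed
  then have "{T \<in> semistandard \<mu>. content \<mu> T = m}
      = {T \<in> {T \<in> semistandard \<mu>. \<forall>d\<in>diagram \<mu>. T d < N}. \<forall>i<N. card {d \<in> diagram \<mu>. T d = i} = count m i}"
    by auto
  also have "card \<dots> = strip_chains (\<lambda>i k. k = count m i) N (rows \<mu>)"
    unfolding diagram_eq_cells semistandard_bounded_eq_tableaux[unfolded diagram_eq_cells]
    by (rule card_tableaux_content[OF rows_in_shapes])
  finally show ?thesis by (simp add: s_fun_def)
qed

text \<open>Substituting ones keeps the monomials in the first \<open>b\<close> variables, each with
  weight 1, so all tableaux with entries below \<open>b\<close> are counted. They have finitely many
  contents, which gives the finite support that \<open>Sum_any\<close> requires.\<close>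

lemma evaluate_ones_s_fun: "evaluate_ones b (s_fun \<mu>) = of_nat (all_chains b (rows \<mu>))"
proof -
  let ?T = "tableaux b (rows \<mu>)"
  let ?C = "content \<mu> ` ?T"
  have fin: "finite ?T" by (rule finite_tableaux[OF rows_in_shapes])
  have w: "(\<Prod>i\<in>#m. if i < b then 1 else 0) = (if set_mset m \<subseteq> {..<b} then 1 else 0 :: complex)" for m
    by (induction m) auto
  have fibre: "{T \<in> semistandard \<mu>. content \<mu> T = m} = {T \<in> ?T. content \<mu> T = m}"
    if "set_mset m \<subseteq> {..<b}" for m
    unfolding semistandard_bounded_eq_tableaux[symmetric] using that set_content[of \<mu>] by fastforce
  have sub: "set_mset m \<subseteq> {..<b}" if "m \<in> ?C" for m
    using that unfolding semistandard_bounded_eq_tableaux[symmetric] by (auto simp: set_content)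
  let ?g = "\<lambda>m. coeff (s_fun \<mu>) m * (\<Prod>i\<in>#m. if i < b then 1 else 0)"
  have "?g m = 0" if "m \<notin> ?C" for m
  proof (cases "set_mset m \<subseteq> {..<b}")
    case True
    then have empty: "{T \<in> semistandard \<mu>. content \<mu> T = m} = {}" using fibre that by auto
    show ?thesis unfolding s_fun_def coeff_Abs empty by simp
  qed (simp add: w)
  then have "evaluate_ones b (s_fun \<mu>) = (\<Sum>m\<in>?C. ?g m)"
    unfolding evaluate_ones_def evaluate_def using fin by (intro Sum_any.expand_superset) auto
  also have "\<dots> = (\<Sum>m\<in>?C. of_nat (card {T \<in> ?T. content \<mu> T = m}))"
    using sub fibre by (intro sum.cong refl) (simp add: w s_fun_def)
  also have "\<dots> = of_nat (\<Sum>m\<in>?C. \<Sum>T | T \<in> ?T \<and> content \<mu> T = m. 1)"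
    by simp
  also have "(\<Sum>m\<in>?C. \<Sum>T | T \<in> ?T \<and> content \<mu> T = m. 1) = (\<Sum>T\<in>?T. 1 :: nat)"
    by (rule sum.image_gen[OF fin, symmetric])
  also have "\<dots> = card ?T" by simp
  also have "\<dots> = all_chains b (rows \<mu>)"
    using card_tableaux_content[OF rows_in_shapes, of b \<mu> "\<lambda>_ _. True"] by simp
  finally show ?thesis .
qed

lemma s_expansion_h_copies: "(\<Sum>\<mu>\<in>partitions n. scale (evaluate_ones b (s_fun \<mu>)) (s_fun \<mu>)) = h_copies b n"
proof (rule mseries_eqI)
  fix m :: "nat multiset"
  obtain N where N: "set_mset m \<subseteq> {..<N}"
    using finite_nat_set_iff_bounded[of "set_mset m"] by auto
  let ?K = "strip_chains (\<lambda>i k. k = count m i) N"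
  have size: "size m = (\<Sum>i<N. count m i)"
    unfolding size_multiset_overloaded_eq using N
    by (intro sum.mono_neutral_left) (auto simp: not_in_iff)
  have "coeff (\<Sum>\<mu>\<in>partitions n. scale (evaluate_ones b (s_fun \<mu>)) (s_fun \<mu>)) m
      = of_nat (\<Sum>\<mu>\<in>partitions n. ?K (rows \<mu>) * all_chains b (rows \<mu>))"
    by (simp add: evaluate_ones_s_fun coeff_s_fun[OF N] mult.commute)
  also have "(\<Sum>\<mu>\<in>partitions n. ?K (rows \<mu>) * all_chains b (rows \<mu>))
      = (\<Sum>l | l \<in> shapes \<and> shape_size l = n. ?K l * all_chains b l)"
    using sum.reindex_bij_betw[OF bij_betw_rows, of "\<lambda>l. ?K l * all_chains b l"] .
  also have "\<dots> = (if size m = n then multichoose_weight b m else 0)"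
  proof (cases "size m = n")
    case True
    then show ?thesis
      using sum_chains_all_chains[where n = N and c = "count m" and b = b] N
      by (simp add: size multichoose_weight_superset[of "{..<N}"])
  next
    case False
    then have "?K l = 0" if "l \<in> shapes \<and> shape_size l = n" for l
      using that by (intro chains_content_eq_0) (auto simp: size)
    then show ?thesis using False by simp
  qed
  finally show "coeff (\<Sum>\<mu>\<in>partitions n. scale (evaluate_ones b (s_fun \<mu>)) (s_fun \<mu>)) m
      = coeff (h_copies b n) m"
    by (simp add: coeff_h_copies)
qed

section \<open>Characters and cycle types\<close>

lemma perm_character_eq_card_fixed:
  assumes "finite X"
  shows "perm_character X act \<sigma> = of_nat (card {x \<in> X. act \<sigma> x = x})"
proof -
  have "perm_rep (act \<sigma>) (Poly_Mapping.single x 1) = Poly_Mapping.single (act \<sigma> x) 1" for x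
    by (simp add: perm_rep_def)
  then have "perm_character X act \<sigma> = (\<Sum>x\<in>X. if act \<sigma> x = x then 1 else 0)"
    by (simp add: perm_character_def trace_on_def lookup_single when_def)
  also have "\<dots> = of_nat (card {x \<in> X. act \<sigma> x = x})"
    using assms by (subst sum.inter_filter[symmetric]) simp_all
  finally show ?thesis .
qed

lemma size_cycle_type: "size (cycle_type n \<sigma>) = card (orbit \<sigma> ` {1..n})"
  by (simp add: cycle_type_def)

text \<open>Needed since \<open>class_value\<close> is a definite description, which determines
  nothing on a class without permutations. The induction adds a block of \<open>k\<close> new points
  that are permuted cyclically.\<close>

lemma exists_permutation_of_cycle_type:
  assumes "\<mu> \<in> partitions n"
  obtains \<sigma> where "\<sigma> permutes {1..n}" "cycle_type n \<sigma> = \<mu>"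
proof -
  have "\<exists>\<sigma>. \<sigma> permutes {1..sum_mset \<mu>} \<and> cycle_type (sum_mset \<mu>) \<sigma> = \<mu>" if "0 \<notin># \<mu>"
    using that
  proof (induction \<mu>)
    case empty
    show ?case by (intro exI[of _ id]) (auto simp: cycle_type_def)
  next
    case (add k \<mu>)
    define n where "n = sum_mset \<mu>"
    from add obtain \<sigma> where \<sigma>: "\<sigma> permutes {1..n}" "cycle_type n \<sigma> = \<mu>"
      by (auto simp: n_def)
    have k: "k > 0" using add.prems by auto
    define \<tau> where "\<tau> x = (if x \<in> {1..n} then \<sigma> x else if n < x \<and> x < n + k then Suc x
        else if x = n + k then Suc n else x)" for x
    have \<sigma>_in: "\<sigma> x \<in> {1..n} \<longleftrightarrow> x \<in> {1..n}" for x
      using permutes_in_image[OF \<sigma>(1)] .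
    have inj: "inj_on \<tau> {1..n + k}"
    proof (rule inj_onI)
      fix x y assume xy: "x \<in> {1..n + k}" "y \<in> {1..n + k}" "\<tau> x = \<tau> y"
      show "x = y"
      proof (cases "x \<in> {1..n} \<or> y \<in> {1..n}")
        case True
        then have "x \<in> {1..n} \<and> y \<in> {1..n}"
          using xy \<sigma>_in[of x] \<sigma>_in[of y] by (auto simp: \<tau>_def split: if_splits)
        then show ?thesis
          using xy permutes_inj[OF \<sigma>(1)] by (auto simp: \<tau>_def dest: injD)
      next
        case False
        then show ?thesis using xy by (auto simp: \<tau>_def split: if_splits)
      qed
    qed
    have "\<tau> ` {1..n + k} \<subseteq> {1..n + k}"
    proof
      fix y assume "y \<in> \<tau> ` {1..n + k}"
      then obtain x where "x \<in> {1..n + k}" "y = \<tau> x" by blast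
      then show "y \<in> {1..n + k}"
        using \<sigma>_in[of x] k by (auto simp: \<tau>_def split: if_splits)
    qed
    with inj have "bij_betw \<tau> {1..n + k} {1..n + k}"
      by (simp add: bij_betw_def endo_inj_surj)
    then have perm: "\<tau> permutes {1..n + k}"
      by (rule bij_imp_permutes) (use k in \<open>auto simp: \<tau>_def\<close>)
    have old: "orbit \<tau> x = orbit \<sigma> x" if "x \<in> {1..n}" for x
    proof (rule orbit_cong0[symmetric])
      show "\<sigma> \<in> {1..n} \<rightarrow> {1..n}" using \<sigma>_in by blast
    qed (use that in \<open>simp_all add: \<tau>_def\<close>)
    have pow: "j < k \<Longrightarrow> (\<tau> ^^ j) (Suc n) = Suc (n + j)" for j
      by (induction j) (auto simp: \<tau>_def)
    have "(\<tau> ^^ k) (Suc n) = Suc n"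
      using pow[of "k - 1"] k by (cases k) (auto simp: \<tau>_def)
    then have "orbit \<tau> (Suc n) = {(\<tau> ^^ m) (Suc n) | m. m < k}"
      using k by (rule orbit_altdef_bounded)
    also have "\<dots> = (\<lambda>m. Suc (n + m)) ` {..<k}"
      using pow by force
    also have "\<dots> = {n<..n + k}"
      by (auto simp: image_iff Bex_def less_eq_Suc_le dest!: le_Suc_ex)
    finally have "orbit \<tau> (Suc n) = {n<..n + k}" .
    then have "cyclic_on \<tau> {n<..n + k}"
      using k by (intro cyclic_on_singleI[of "Suc n"]) auto
    then have new: "orbit \<tau> x = {n<..n + k}" if "x \<in> {n<..n + k}" for x
      using that by (rule orbit_cyclic_eq3)
    have "{1..n + k} = {n<..n + k} \<union> {1..n}" by auto
    then have "orbit \<tau> ` {1..n + k} = orbit \<tau> ` {n<..n + k} \<union> orbit \<tau> ` {1..n}"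
      by (metis image_Un)
    moreover have "orbit \<tau> ` {n<..n + k} = {{n<..n + k}}"
      using new k by (auto simp: image_iff intro!: exI[of _ "n + k"])
    moreover have "orbit \<tau> ` {1..n} = orbit \<sigma> ` {1..n}"
      using old by (intro image_cong) auto
    ultimately have img: "orbit \<tau> ` {1..n + k} = insert {n<..n + k} (orbit \<sigma> ` {1..n})"
      by simp
    \<comment> \<open>\<open>cycle_type\<close> collects orbits in a set, so the new orbit must
      differ from the old ones for \<open>k\<close> to be added once more.\<close>
    have "{n<..n + k} \<notin> orbit \<sigma> ` {1..n}"
      using permutes_orbit_subset[OF \<sigma>(1)] k by fastforce
    then have "cycle_type (n + k) \<tau> = add_mset k (cycle_type n \<sigma>)"
      unfolding cycle_type_def img by simp
    with perm \<sigma> show ?case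
      by (intro exI[of _ \<tau>]) (simp add: n_def add.commute)
  qed
  then show thesis using assms that by (auto simp: partitions_def)
qed

lemma class_value_eq:
  assumes "\<mu> \<in> partitions n"
    and "\<And>\<sigma>. \<sigma> permutes {1..n} \<Longrightarrow> \<chi> \<sigma> = c (cycle_type n \<sigma>)"
  shows "class_value n \<chi> \<mu> = c \<mu>"
proof -
  obtain \<tau> where "\<tau> permutes {1..n}" "cycle_type n \<tau> = \<mu>"
    using exists_permutation_of_cycle_type[OF assms(1)] .
  then show ?thesis
    unfolding class_value_def using assms(2) by (intro the_equality) blast+
qed

lemma card_invariant_functions:
  assumes "\<sigma> permutes {1..a}"
  shows "card {f \<in> {1..a} \<rightarrow>\<^sub>E {..<b}. \<forall>l\<in>{1..a}. f (\<sigma> l) = f l} = b ^ size (cycle_type a \<sigma>)"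
proof -
  let ?O = "orbit \<sigma> ` {1..a}"
  let ?\<Omega> = "{f \<in> {1..a} \<rightarrow>\<^sub>E {..<b}. \<forall>l\<in>{1..a}. f (\<sigma> l) = f l}"
  let ?F = "\<lambda>g. \<lambda>l\<in>{1..a}. g (orbit \<sigma> l)"
  have sub: "orbit \<sigma> l \<subseteq> {1..a}" if "l \<in> {1..a}" for l
    using permutes_orbit_subset[OF assms that] .
  have perm: "permutation \<sigma>"
    using assms permutation_permutes by blast
  have "bij_betw ?F (?O \<rightarrow>\<^sub>E {..<b}) ?\<Omega>"
  proof (rule bij_betwI[where g = "\<lambda>f. \<lambda>U\<in>?O. the_elem (f ` U)"])
    show "?F \<in> (?O \<rightarrow>\<^sub>E {..<b}) \<rightarrow> ?\<Omega>"
      using permutes_in_image[OF assms] by (auto simp: permutation_orbit_step[OF perm] PiE_iff)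
    have const: "f ` orbit \<sigma> l = {f l}" if f: "f \<in> ?\<Omega>" and l: "l \<in> {1..a}" for f l
    proof -
      have "f y = f l" if "y \<in> orbit \<sigma> l" for y
        using that
      proof induction
        case base
        then show ?case using f l by auto
      next
        case (step y)
        then show ?case using f l sub[OF l] by auto
      qed
      then show ?thesis using orbit_nonempty by force
    qed
    show "(\<lambda>f. \<lambda>U\<in>?O. the_elem (f ` U)) \<in> ?\<Omega> \<rightarrow> ?O \<rightarrow>\<^sub>E {..<b}"
      using const by (auto simp: PiE_iff)
    show "(\<lambda>U\<in>?O. the_elem (?F g ` U)) = g" if g: "g \<in> ?O \<rightarrow>\<^sub>E {..<b}" for g
    proof (rule ext)
      fix U
      show "(\<lambda>U\<in>?O. the_elem (?F g ` U)) U = g U"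
      proof (cases "U \<in> ?O")
        case True
        then obtain l where l: "l \<in> {1..a}" "U = orbit \<sigma> l" by blast
        have "?F g \<in> ?\<Omega>"
          using g permutes_in_image[OF assms] by (auto simp: permutation_orbit_step[OF perm] PiE_iff)
        then have "?F g ` U = {?F g l}" using const l by blast
        then show ?thesis using True l by auto
      next
        case False
        then show ?thesis using g by (auto simp: PiE_iff extensional_def)
      qed
    qed
    show "?F (\<lambda>U\<in>?O. the_elem (f ` U)) = f" if f: "f \<in> ?\<Omega>" for f
    proof (rule ext)
      fix l
      show "?F (\<lambda>U\<in>?O. the_elem (f ` U)) l = f l"
        using f const[OF f, of l] by (cases "l \<in> {1..a}") (auto simp: PiE_iff extensional_def)
    qed
  qed
  then have "card ?\<Omega> = card (?O \<rightarrow>\<^sub>E {..<b})"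
    by (simp add: bij_betw_same_card)
  also have "\<dots> = b ^ card ?O"
    by (subst card_PiE) auto
  finally show ?thesis by (simp add: size_cycle_type)
qed

section \<open>The cycle lemma\<close>

text \<open>
  A parking function is encoded by the map sending a label to its column. The path stays above the
  line iff it does so at its lowest points, namely at the end of each east step.
\<close>

definition parking_maps :: "nat \<Rightarrow> nat \<Rightarrow> (nat \<Rightarrow> nat) set" where
  "parking_maps a b = {f \<in> {1..a} \<rightarrow>\<^sub>E {..<b}. \<forall>x\<le>b. a * x \<le> b * card {l \<in> {1..a}. f l < x}}"

text \<open>Column \<open>s\<close> becomes column 0. Adding \<open>b - s\<close> stands for
  subtracting \<open>s\<close> modulo \<open>b\<close>, as subtraction on naturals
  truncates.\<close>

definition rotate_map :: "nat \<Rightarrow> nat \<Rightarrow> nat \<Rightarrow> (nat \<Rightarrow> nat) \<Rightarrow> nat \<Rightarrow> nat" where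
  "rotate_map a b s f = (\<lambda>l\<in>{1..a}. (f l + (b - s)) mod b)"

lemma rotate_value:
  assumes "v < b" "s < (b::nat)"
  shows "(v + (b - s)) mod b = (if s \<le> v then v - s else v + b - s)"
proof (cases "s \<le> v")
  case True
  then have "(v + (b - s)) mod b = ((v - s) + b) mod b"
    using assms by (intro arg_cong[of _ _ "\<lambda>x. x mod b"]) simp
  also have "\<dots> = v - s" using assms by simp
  finally show ?thesis using True by simp
qed (use assms in simp)

text \<open>\<open>g x\<close> is \<open>b\<close> times the height of the path over the line where
  it arrives at abscissa \<open>x\<close>. As every label has its column below \<open>b\<close>,
  \<open>g b = g 0 = 0\<close>, so \<open>g\<close> extends periodically and rotation by
  \<open>s\<close> replaces it by \<open>g (s + x) - g s\<close>; this is nonnegative for all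
  \<open>x\<close> iff \<open>g\<close> is minimal at \<open>s\<close>.\<close>

lemma rotate_map_in_parking_maps_iff:
  assumes f: "f \<in> {1..a} \<rightarrow>\<^sub>E {..<b}" and s: "s < b"
  defines "g \<equiv> \<lambda>x. int b * int (card {l \<in> {1..a}. f l < x}) - int a * int x"
  shows "rotate_map a b s f \<in> parking_maps a b \<longleftrightarrow> (\<forall>y<b. g s \<le> g y)"
proof -
  let ?r = "rotate_map a b s f"
  define F where "F x = card {l \<in> {1..a}. f l < x}" for x
  define R where "R x = card {l \<in> {1..a}. ?r l < x}" for x
  have fb: "f l < b" if "l \<in> {1..a}" for l using f that by auto
  have r: "?r l = (if s \<le> f l then f l - s else f l + b - s)" if "l \<in> {1..a}" for l
    using that rotate_value[OF fb[OF that] s] by (simp add: rotate_map_def)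
  \<comment> \<open>The first \<open>x\<close> columns after rotation are the \<open>x\<close>
    columns from \<open>s\<close> on. In \<open>low\<close> this window stops short of the last
    column; in \<open>high\<close> it reaches it and may continue at column 0.\<close>
  have low: "R x + F s = F (s + x)" if "s + x < b" for x
  proof -
    have "{l \<in> {1..a}. f l < s + x} = {l \<in> {1..a}. ?r l < x} \<union> {l \<in> {1..a}. f l < s}"
      using that fb by (auto simp: r split: if_splits)
    moreover have "{l \<in> {1..a}. ?r l < x} \<inter> {l \<in> {1..a}. f l < s} = {}"
      using that by (auto simp: r)
    ultimately show ?thesis
      unfolding R_def F_def by (simp add: card_Un_disjoint)
  qed
  have high: "R x + F s = a + F (x + s - b)" if "b \<le> s + x" "x \<le> b" for x
  proof -
    have "{l \<in> {1..a}. ?r l < x} = {l \<in> {1..a}. s \<le> f l} \<union> {l \<in> {1..a}. f l < x + s - b}"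
      using that s fb by (auto simp: r split: if_splits) (use fb in fastforce)
    moreover have "{l \<in> {1..a}. s \<le> f l} \<inter> {l \<in> {1..a}. f l < x + s - b} = {}"
      using that by auto
    ultimately have "R x = card {l \<in> {1..a}. s \<le> f l} + F (x + s - b)"
      unfolding R_def F_def by (simp add: card_Un_disjoint)
    moreover have "a = card ({l \<in> {1..a}. s \<le> f l} \<union> {l \<in> {1..a}. f l < s})"
    proof -
      have "{l \<in> {1..a}. s \<le> f l} \<union> {l \<in> {1..a}. f l < s} = {1..a}" by auto
      then show ?thesis by simp
    qed
    then have "a = card {l \<in> {1..a}. s \<le> f l} + F s"
      unfolding F_def by (subst (asm) card_Un_disjoint) auto
    ultimately show ?thesis by simp
  qed
  have gF: "g x = int b * int (F x) - int a * int x" for x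
    by (simp add: g_def F_def)
  have "?r \<in> {1..a} \<rightarrow>\<^sub>E {..<b}"
    using s by (auto simp: rotate_map_def)
  then have "?r \<in> parking_maps a b \<longleftrightarrow> (\<forall>x\<le>b. int a * int x \<le> int b * int (R x))"
    by (simp add: parking_maps_def R_def flip: of_nat_mult)
  also have "\<dots> \<longleftrightarrow> (\<forall>y<b. g s \<le> g y)"
  proof -
    have lowg: "int b * int (R x) - int a * int x = g (s + x) - g s" if "s + x < b" for x
    proof -
      have R: "int (R x) = int (F (s + x)) - int (F s)"
        using low[OF that] by linarith
      show ?thesis by (simp add: gF R algebra_simps)
    qed
    have highg: "int b * int (R x) - int a * int x = g (x + s - b) - g s" if "b \<le> s + x" "x \<le> b" for x
    proof -
      have R: "int (R x) = int a + int (F (x + s - b)) - int (F s)"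
        using high[OF that] by linarith
      show ?thesis using that by (simp add: gF R of_nat_diff algebra_simps)
    qed
    show ?thesis
    proof (intro iffI allI impI)
      fix y assume *: "\<forall>x\<le>b. int a * int x \<le> int b * int (R x)" and y: "y < b"
      show "g s \<le> g y"
      proof (cases "s \<le> y")
        case True
        then show ?thesis using * lowg[of "y - s"] y by (auto dest!: spec[of _ "y - s"])
      next
        case False
        then have "y + b - s \<le> b" "b \<le> s + (y + b - s)" "y + b - s + s - b = y" using s by auto
        then show ?thesis using *[rule_format, of "y + b - s"] highg[of "y + b - s"] by simp
      qed
    next
      fix x assume *: "\<forall>y<b. g s \<le> g y" and x: "x \<le> b"
      show "int a * int x \<le> int b * int (R x)"
      proof (cases "s + x < b")
        case True
        then show ?thesis using * lowg[of x] by (auto dest!: spec[of _ "s + x"])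
      next
        case False
        then show ?thesis using * highg[of x] x s by (auto dest!: spec[of _ "x + s - b"])
      qed
    qed
  qed
  finally show ?thesis .
qed

lemma ex1_minimum:
  fixes g :: "'b \<Rightarrow> 'c :: linorder"
  assumes "finite A" "A \<noteq> {}" "inj_on g A"
  shows "\<exists>!s. s \<in> A \<and> (\<forall>y\<in>A. g s \<le> g y)"
proof -
  have "Min (g ` A) \<in> g ` A" using assms by (intro Min_in) auto
  then obtain s where s: "s \<in> A" "g s = Min (g ` A)" by auto
  then have "\<forall>y\<in>A. g s \<le> g y" using assms by simp
  with s(1) show ?thesis
    by (intro ex1I[of _ s]) (auto intro: inj_onD[OF assms(3)] order_antisym)
qed

text \<open>Modulo \<open>b\<close> the value \<open>g x\<close> is \<open>- a * x\<close>, so for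
  \<open>a\<close> coprime to \<open>b\<close> the values at \<open>x < b\<close> are distinct;
  hence the minimum that singles out the rotation is attained exactly once.\<close>

lemma cycle_lemma:
  assumes f: "f \<in> {1..a} \<rightarrow>\<^sub>E {..<b}" and "b > 0" "coprime a b"
  shows "\<exists>!s. s < b \<and> rotate_map a b s f \<in> parking_maps a b"
proof -
  define g where "g x = int b * int (card {l \<in> {1..a}. f l < x}) - int a * int x" for x
  have "inj_on g {..<b}"
  proof (rule inj_onI)
    fix x y assume xy: "x \<in> {..<b}" "y \<in> {..<b}" "g x = g y"
    then have "int a * (int x - int y)
        = int b * (int (card {l \<in> {1..a}. f l < x}) - int (card {l \<in> {1..a}. f l < y}))"
      by (simp add: g_def algebra_simps)
    then have "int b dvd int a * (int x - int y)" by simp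
    moreover have "coprime (int b) (int a)" using assms(3) by (simp add: coprime_commute)
    ultimately have "int b dvd int x - int y" by (simp add: coprime_dvd_mult_right_iff)
    then show "x = y"
      using xy zdvd_imp_le[of "int b" "int x - int y"] zdvd_imp_le[of "int b" "int y - int x"]
      by (cases x y rule: linorder_cases) (auto simp: dvd_diff_commute)
  qed
  then have "\<exists>!s. s \<in> {..<b} \<and> (\<forall>y\<in>{..<b}. g s \<le> g y)"
    using assms(2) by (intro ex1_minimum) auto
  moreover have "s < b \<and> rotate_map a b s f \<in> parking_maps a b
      \<longleftrightarrow> s \<in> {..<b} \<and> (\<forall>y\<in>{..<b}. g s \<le> g y)" for s
    using rotate_map_in_parking_maps_iff[OF f, of s] by (auto simp: g_def)
  ultimately show ?thesis by simp
qed

text \<open>Double counting of pairs of an invariant map and a shift that makes it a parking map.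
  Each map has one such shift; each shift changes only values, hence permutes the invariant maps,
  and accounts for every invariant parking map once.\<close>

lemma card_parking_maps_invariant:
  assumes \<sigma>: "\<sigma> permutes {1..a}" and "b > 0" "coprime a b"
  shows "b * card {f \<in> parking_maps a b. \<forall>l\<in>{1..a}. f (\<sigma> l) = f l} = b ^ size (cycle_type a \<sigma>)"
proof -
  define \<Omega> where "\<Omega> = {f \<in> {1..a} \<rightarrow>\<^sub>E {..<b}. \<forall>l\<in>{1..a}. f (\<sigma> l) = f l}"
  let ?D = "parking_maps a b"
  have fin: "finite \<Omega>"
    unfolding \<Omega>_def by (rule finite_subset[of _ "{1..a} \<rightarrow>\<^sub>E {..<b}"]) (auto intro: finite_PiE)
  have D: "{f \<in> ?D. \<forall>l\<in>{1..a}. f (\<sigma> l) = f l} = {f \<in> \<Omega>. f \<in> ?D}"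
    by (auto simp: \<Omega>_def parking_maps_def)
  have bij: "bij_betw (rotate_map a b s) \<Omega> \<Omega>" if s: "s < b" for s
  proof -
    have "inj_on (rotate_map a b s) \<Omega>"
    proof (rule inj_onI)
      fix f f' assume ff: "f \<in> \<Omega>" "f' \<in> \<Omega>" "rotate_map a b s f = rotate_map a b s f'"
      show "f = f'"
      proof (rule PiE_ext[of _ "{1..a}" "\<lambda>_. {..<b}"])
        fix l assume l: "l \<in> {1..a}"
        have lt: "f l < b" "f' l < b" using ff l by (auto simp: \<Omega>_def)
        have "(f l + (b - s)) mod b = (f' l + (b - s)) mod b"
          using fun_cong[OF ff(3), of l] l by (simp add: rotate_map_def)
        then show "f l = f' l"
          using lt s unfolding rotate_value[OF lt(1) s] rotate_value[OF lt(2) s]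
          by (auto split: if_splits)
      qed (use ff in \<open>auto simp: \<Omega>_def\<close>)
    qed
    moreover have "rotate_map a b s ` \<Omega> \<subseteq> \<Omega>"
      using permutes_in_image[OF \<sigma>] assms(2) by (auto simp: \<Omega>_def rotate_map_def)
    ultimately show ?thesis
      using fin by (simp add: bij_betw_def endo_inj_surj)
  qed
  have "card \<Omega> = (\<Sum>f\<in>\<Omega>. \<Sum>s<b. if rotate_map a b s f \<in> ?D then 1 else 0)"
  proof -
    have "(\<Sum>s<b. if rotate_map a b s f \<in> ?D then 1 else 0) = (1 :: nat)" if "f \<in> \<Omega>" for f
    proof -
      from that have "f \<in> {1..a} \<rightarrow>\<^sub>E {..<b}" by (simp add: \<Omega>_def)
      from cycle_lemma[OF this assms(2,3)] obtain s
        where "{s \<in> {..<b}. rotate_map a b s f \<in> ?D} = {s}" by auto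
      then show ?thesis by (subst sum.inter_filter[symmetric]) simp_all
    qed
    then show ?thesis by simp
  qed
  also have "\<dots> = (\<Sum>s<b. \<Sum>f\<in>\<Omega>. if rotate_map a b s f \<in> ?D then 1 else 0)"
    by (rule sum.swap)
  also have "\<dots> = (\<Sum>s<b. \<Sum>f\<in>\<Omega>. if f \<in> ?D then 1 else 0)"
    using sum.reindex_bij_betw[OF bij, of _ "\<lambda>f. if f \<in> ?D then 1 else 0"]
    by (rule sum.cong[OF refl]) simp
  also have "\<dots> = b * card {f \<in> \<Omega>. f \<in> ?D}"
    using fin by (subst sum.inter_filter[symmetric]) simp_all
  finally show ?thesis
    unfolding D using card_invariant_functions[OF \<sigma>, of b, folded \<Omega>_def] by simp
qed


section \<open>Parking functions as maps from labels to columns\<close>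

lemma north_columns_Nil [simp]: "north_columns [] = []"
  by (simp add: north_columns_def)

lemma north_columns_Cons:
  "north_columns (s # p) = (if s = North then 0 # north_columns p else map Suc (north_columns p))"
proof -
  have idx: "[0..<length (s # p)] = 0 # map Suc [0..<length p]"
    by (simp add: upt_conv_Cons map_Suc_upt del: upt_Suc)
  show ?thesis
    unfolding north_columns_def idx
    by (cases s) (simp_all add: filter_map comp_def del: upt_Suc)
qed

lemma length_north_columns [simp]: "length (north_columns p) = count_list p North"
  by (induction p) (auto simp: north_columns_Cons)

lemma sorted_north_columns: "sorted (north_columns p)"
  by (induction p) (auto simp: north_columns_Cons sorted_map)

text \<open>East steps after the last north step leave no trace in \<open>north_columns\<close>; the
  total number of east steps supplies them.\<close>

lemma north_columns_inject:
  "north_columns p = north_columns q \<Longrightarrow> count_list p East = count_list q East \<Longrightarrow> p = q"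
proof (induction p arbitrary: q)
  case Nil
  then show ?case
    by (cases q) (auto simp: north_columns_Cons split: if_splits intro: step.exhaust)
next
  case (Cons s p)
  show ?case
  proof (cases q)
    case Nil
    then show ?thesis using Cons.prems by (cases s) (auto simp: north_columns_Cons)
  next
    case q: (Cons t q')
    then show ?thesis
      using Cons.prems Cons.IH[of q']
      by (cases s; cases t) (auto simp: north_columns_Cons Cons_eq_map_conv map_eq_Cons_conv)
  qed
qed

text \<open>The first column decides the first step: 0 asks for a north step; otherwise all columns
  are positive, and an east step lowers them and \<open>b\<close> by one.\<close>

lemma exists_path_with_north_columns:
  "sorted ns \<Longrightarrow> \<forall>n\<in>set ns. n \<le> b \<Longrightarrow> \<exists>p. north_columns p = ns \<and> count_list p East = b"
proof (induction "b + length ns" arbitrary: b ns rule: less_induct)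
  case less
  show ?case
  proof (cases ns)
    case Nil
    have "north_columns (replicate b East) = [] \<and> count_list (replicate b East) East = b"
      by (induction b) (auto simp: north_columns_Cons)
    with Nil show ?thesis by blast
  next
    case (Cons n ns')
    show ?thesis
    proof (cases "n = 0")
      case True
      obtain p where "north_columns p = ns'" "count_list p East = b"
        using less.hyps[of b ns'] less.prems Cons by auto
      then show ?thesis
        using Cons True by (intro exI[of _ "North # p"]) (simp add: north_columns_Cons)
    next
      case False
      then have pos: "\<forall>m\<in>set ns. m > 0" using less.prems Cons by auto
      then have b: "b > 0" using less.prems Cons by (auto intro: Nat.gr0I)
      have "sorted (map (\<lambda>m. m - 1) ns)"
        using less.prems(1) by (auto simp: sorted_map intro: sorted_wrt_mono_rel[rotated])
      moreover have "\<forall>n\<in>set (map (\<lambda>m. m - 1) ns). n \<le> b - 1"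
        using less.prems(2) by auto
      ultimately obtain p where p: "north_columns p = map (\<lambda>m. m - 1) ns" "count_list p East = b - 1"
        using less.hyps[of "b - 1" "map (\<lambda>m. m - 1) ns"] b by auto
      have "map Suc (map (\<lambda>m. m - 1) ns) = ns"
        using pos by (simp add: map_idI)
      then show ?thesis
        using p b by (intro exI[of _ "East # p"]) (simp add: north_columns_Cons)
    qed
  qed
qed

text \<open>The number of north columns below \<open>x\<close> is the height at which the path
  arrives at abscissa \<open>x\<close>, its lowest point there. The starting point
  \<open>(t, s)\<close> is arbitrary so that the first step can be absorbed into it.\<close>

lemma above_line_iff:
  fixes a b s t :: nat
  shows "(\<forall>k\<le>length p. a * (t + count_list (take k p) East) \<le> b * (s + count_list (take k p) North))
    \<longleftrightarrow> (\<forall>x\<le>count_list p East. a * (t + x) \<le> b * (s + length (filter (\<lambda>c. c < x) (north_columns p))))"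
proof (induction p arbitrary: s t)
  case Nil
  show ?case by simp
next
  case (Cons d p)
  have split_Suc: "(\<forall>k\<le>Suc n. P k) \<longleftrightarrow> P 0 \<and> (\<forall>k\<le>n. P (Suc k))" for n and P :: "nat \<Rightarrow> bool"
    by (metis Suc_le_mono not0_implies_Suc zero_le)
  show ?case
  proof (cases d)
    case North
    have "(\<forall>k\<le>length (d # p). a * (t + count_list (take k (d # p)) East) \<le> b * (s + count_list (take k (d # p)) North))
      \<longleftrightarrow> a * t \<le> b * s \<and> (\<forall>k\<le>length p. a * (t + count_list (take k p) East) \<le> b * (Suc s + count_list (take k p) North))"
      unfolding length_Cons split_Suc by (simp add: North)
    also have "\<dots> \<longleftrightarrow> a * t \<le> b * s \<and> (\<forall>x\<le>count_list p East. a * (t + x) \<le> b * (Suc s + length (filter (\<lambda>c. c < x) (north_columns p))))"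
      unfolding Cons.IH ..
    \<comment> \<open>At \<open>x = 0\<close> no column is counted and the condition is that of the
      starting point; for \<open>x > 0\<close> the new column 0 is counted and yields the
      \<open>Suc\<close>.\<close>
    also have "\<dots> \<longleftrightarrow> (\<forall>x\<le>count_list p East. a * (t + x) \<le> b * (s + length (filter (\<lambda>c. c < x) (0 # north_columns p))))"
    proof (intro iffI allI impI conjI, goal_cases)
      case (1 x)
      then show ?case by (cases "x = 0") auto
    next
      case 2
      then show ?case by (auto dest!: spec[of _ 0])
    next
      case (3 x)
      then show ?case
        by (cases "x = 0") (auto dest!: spec[of _ x])
    qed
    finally show ?thesis by (simp add: North north_columns_Cons)
  next
    case East
    have "(\<forall>k\<le>length (d # p). a * (t + count_list (take k (d # p)) East) \<le> b * (s + count_list (take k (d # p)) North))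
      \<longleftrightarrow> a * t \<le> b * s \<and> (\<forall>k\<le>length p. a * (Suc t + count_list (take k p) East) \<le> b * (s + count_list (take k p) North))"
      unfolding length_Cons split_Suc by (simp add: East)
    also have "\<dots> \<longleftrightarrow> a * t \<le> b * s \<and> (\<forall>x\<le>count_list p East. a * (Suc t + x) \<le> b * (s + length (filter (\<lambda>c. c < x) (north_columns p))))"
      unfolding Cons.IH ..
    also have "\<dots> \<longleftrightarrow> (\<forall>x\<le>Suc (count_list p East). a * (t + x) \<le> b * (s + length (filter (\<lambda>c. c < x) (map Suc (north_columns p)))))"
      unfolding split_Suc by (simp add: filter_map comp_def)
    finally show ?thesis by (simp add: East north_columns_Cons)
  qed
qed

lemma dyck_paths_iff:
  assumes "b > 0"
  shows "p \<in> dyck_paths a b \<longleftrightarrow> count_list p North = a \<and> count_list p East = b \<and>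
    (\<forall>x\<le>b. a * x \<le> b * length (filter (\<lambda>c. c < x) (north_columns p)))"
proof -
  have "real (count_list (take k p) North) \<ge> real a / real b * real (count_list (take k p) East)
      \<longleftrightarrow> a * (0 + count_list (take k p) East) \<le> b * (0 + count_list (take k p) North)" for k
  proof -
    have "real (count_list (take k p) North) \<ge> real a / real b * real (count_list (take k p) East)
        \<longleftrightarrow> real (a * count_list (take k p) East) \<le> real (b * count_list (take k p) North)"
      using assms by (simp add: field_simps)
    then show ?thesis unfolding of_nat_le_iff by simp
  qed
  then have "p \<in> dyck_paths a b \<longleftrightarrow> count_list p North = a \<and> count_list p East = b \<and>
      (\<forall>k\<le>length p. a * (0 + count_list (take k p) East) \<le> b * (0 + count_list (take k p) North))"
    by (simp add: dyck_paths_def)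
  then show ?thesis unfolding above_line_iff by auto
qed

text \<open>
  In terms of the pairs (column, label), ordered lexicographically, a parking function is the
  sorted list of the graph of its parking map.
\<close>

definition graph_list :: "nat \<Rightarrow> (nat \<Rightarrow> nat) \<Rightarrow> (nat \<times> nat) list" where
  "graph_list a f = sorted_list_of_set ((\<lambda>l. (f l, l)) ` {1..a})"

lemma set_graph_list [simp]: "set (graph_list a f) = (\<lambda>l. (f l, l)) ` {1..a}"
  by (simp add: graph_list_def)

lemma length_graph_list [simp]: "length (graph_list a f) = a"
  by (simp add: graph_list_def card_image inj_on_def)

lemma sorted_graph_list: "sorted (graph_list a f)"
  by (simp add: graph_list_def)

lemma distinct_graph_list: "distinct (graph_list a f)"
  by (simp add: graph_list_def)

lemma sorted_map_fst_graph_list: "sorted (map fst (graph_list a f))"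
  unfolding sorted_map using sorted_graph_list
  by (rule sorted_wrt_mono_rel[rotated]) (auto simp: less_eq_prod_def)

lemma length_filter_graph_list:
  "length (filter (\<lambda>c. c < x) (map fst (graph_list a f))) = card {l \<in> {1..a}. f l < x}"
proof -
  have "length (filter (\<lambda>c. c < x) (map fst (graph_list a f)))
      = length (filter (\<lambda>z. fst z < x) (graph_list a f))"
    by (simp add: filter_map comp_def)
  also have "\<dots> = card (set (filter (\<lambda>z. fst z < x) (graph_list a f)))"
    by (rule distinct_card[symmetric]) (simp add: distinct_graph_list)
  also have "set (filter (\<lambda>z. fst z < x) (graph_list a f)) = (\<lambda>l. (f l, l)) ` {l \<in> {1..a}. f l < x}"
    by auto
  also have "card \<dots> = card {l \<in> {1..a}. f l < x}"
    by (rule card_image) (auto simp: inj_on_def)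
  finally show ?thesis .
qed

text \<open>A relation, because recovering \<open>f\<close> from a labelled path inverts the
  labelling. \<open>extensional\<close> makes \<open>f\<close> unique. Trailing east steps are not
  recorded, so the number of east steps is a separate condition in what follows.\<close>

definition encodes :: "nat \<Rightarrow> (nat \<Rightarrow> nat) \<Rightarrow> step list \<times> nat list \<Rightarrow> bool" where
  "encodes a f x \<longleftrightarrow> f \<in> extensional {1..a} \<and>
     north_columns (fst x) = map fst (graph_list a f) \<and> snd x = map snd (graph_list a f)"

text \<open>The conditions on labels hold automatically, since the lexicographic order breaks ties
  within a column by the label; what remains is the Dyck condition.\<close>

lemma encodes_parking_functions_iff:
  assumes "encodes a f (p, w)" "b > 0"
  shows "(p, w) \<in> parking_functions a b \<longleftrightarrow> count_list p East = b \<and> f \<in> parking_maps a b"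
proof -
  let ?z = "graph_list a f"
  from assms(1) have enc: "f \<in> extensional {1..a}" "north_columns p = map fst ?z" "w = map snd ?z"
    by (simp_all add: encodes_def)
  have north: "count_list p North = a"
    using arg_cong[OF enc(2), of length] by simp
  have "distinct w" "set w = {1..a}"
    unfolding enc(3) distinct_map using distinct_graph_list by (auto simp: inj_on_def image_iff)
  moreover have "length w = a" by (simp add: enc(3))
  ultimately have bij: "bij_betw (\<lambda>i. w ! i) {..<a} {1..a}"
    using bij_betw_nth[of w "{..<a}" "{1..a}"] by auto
  have sorted_labels: "w ! i < w ! j"
    if "i < j" "j < a" "north_columns p ! i = north_columns p ! j" for i j
  proof -
    have "?z ! i \<le> ?z ! j" "?z ! i \<noteq> ?z ! j"
      using that sorted_nth_mono[OF sorted_graph_list[of a f], of i j]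
        nth_eq_iff_index_eq[OF distinct_graph_list[of a f], of i j] by auto
    then show ?thesis
      using that by (auto simp: enc(2,3) less_eq_prod_def prod_eq_iff)
  qed
  \<comment> \<open>At \<open>x = b\<close> the inequality says that all \<open>a\<close> labels lie
    in columns below \<open>b\<close>.\<close>
  have range: "f \<in> {1..a} \<rightarrow>\<^sub>E {..<b}"
    if "\<forall>x\<le>b. a * x \<le> b * card {l \<in> {1..a}. f l < x}"
  proof -
    have "a \<le> card {l \<in> {1..a}. f l < b}" using that assms(2) by (auto simp: mult.commute)
    then have "{l \<in> {1..a}. f l < b} = {1..a}"
      by (intro card_seteq) auto
    then show ?thesis using enc(1) by (auto simp: PiE_iff)
  qed
  have "(p, w) \<in> parking_functions a b \<longleftrightarrow> p \<in> dyck_paths a b"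
    using bij sorted_labels \<open>length w = a\<close> by (auto simp: parking_functions_def)
  also have "\<dots> \<longleftrightarrow> count_list p East = b \<and> (\<forall>x\<le>b. a * x \<le> b * card {l \<in> {1..a}. f l < x})"
    unfolding dyck_paths_iff[OF assms(2)] enc(2) length_filter_graph_list using north by blast
  also have "\<dots> \<longleftrightarrow> count_list p East = b \<and> f \<in> parking_maps a b"
    using range by (auto simp: parking_maps_def)
  finally show ?thesis .
qed

text \<open>Increasing labels within columns make the list of pairs strictly increasing in the
  lexicographic order, and such a list is determined by its set, here the graph of
  \<open>f\<close>.\<close>

lemma parking_function_encoded:
  assumes "(p, w) \<in> parking_functions a b"
  obtains f where "encodes a f (p, w)"
proof -
  let ?n = "north_columns p"
  have len: "length w = a" "length ?n = a" and bij: "bij_betw (\<lambda>i. w ! i) {..<a} {1..a}"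
    and lab: "\<And>i j. i < j \<Longrightarrow> j < a \<Longrightarrow> ?n ! i = ?n ! j \<Longrightarrow> w ! i < w ! j"
    using assms by (auto simp: parking_functions_def dyck_paths_def)
  define f where "f = (\<lambda>l\<in>{1..a}. ?n ! the_inv_into {..<a} (\<lambda>i. w ! i) l)"
  have fw: "f (w ! i) = ?n ! i" if "i < a" for i
    using that bij by (auto simp: f_def bij_betw_def the_inv_into_f_f)
  have "set (zip ?n w) = (\<lambda>i. (?n ! i, w ! i)) ` {..<a}"
    using len by (auto simp: set_zip)
  also have "\<dots> = (\<lambda>l. (f l, l)) ` ((\<lambda>i. w ! i) ` {..<a})"
    unfolding image_image using fw by (intro image_cong) auto
  also have "(\<lambda>i. w ! i) ` {..<a} = {1..a}" using bij by (simp add: bij_betw_def)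
  finally have set: "set (zip ?n w) = (\<lambda>l. (f l, l)) ` {1..a}" .
  have "sorted_wrt (<) (zip ?n w)"
    unfolding sorted_wrt_iff_nth_less
  proof (intro allI impI)
    fix i j assume ij: "i < j" "j < length (zip ?n w)"
    then have "?n ! i \<le> ?n ! j"
      using sorted_nth_mono[OF sorted_north_columns[of p], of i j] by simp
    then show "zip ?n w ! i < zip ?n w ! j"
      using lab[of i j] ij len by (auto simp: less_prod_def less_le)
  qed
  then have "zip ?n w = graph_list a f"
    unfolding graph_list_def set[symmetric]
    by (metis sorted_list_of_set.idem_if_sorted_distinct strict_sorted_iff)
  moreover have "map fst (zip ?n w) = ?n" "map snd (zip ?n w) = w" using len by simp_all
  ultimately have "encodes a f (p, w)"
    by (simp add: encodes_def f_def)
  then show thesis by (rule that)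
qed

lemma encodes_unique:
  assumes "encodes a f x" "encodes a g x"
  shows "f = g"
proof -
  have "graph_list a f = graph_list a g"
    using assms by (metis encodes_def zip_map_fst_snd)
  then have img: "(\<lambda>l. (f l, l)) ` {1..a} = (\<lambda>l. (g l, l)) ` {1..a}"
    using set_graph_list by metis
  have "f l = g l" if "l \<in> {1..a}" for l
  proof -
    have "(f l, l) \<in> (\<lambda>l. (g l, l)) ` {1..a}" using that img by blast
    then show ?thesis by auto
  qed
  then show ?thesis
    using assms by (intro extensionalityI[of _ "{1..a}"]) (auto simp: encodes_def)
qed

lemma bij_betw_parking_functions:
  assumes "b > 0"
  shows "bij_betw (\<lambda>x. THE f. encodes a f x) (parking_functions a b) (parking_maps a b)"
proof -
  have the: "(THE f. encodes a f x) = f" if "encodes a f x" for f x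
    using that encodes_unique by blast
  have ex: "\<exists>f. encodes a f x" if "x \<in> parking_functions a b" for x
    using that parking_function_encoded by (cases x) metis
  show ?thesis
  proof (rule bij_betw_imageI)
    show "inj_on (\<lambda>x. THE f. encodes a f x) (parking_functions a b)"
    proof (rule inj_onI)
      fix x y
      assume xy: "x \<in> parking_functions a b" "y \<in> parking_functions a b"
        "(THE f. encodes a f x) = (THE f. encodes a f y)"
      then obtain f where f: "encodes a f x" "encodes a f y"
        using ex the by metis
      have "count_list (fst x) East = count_list (fst y) East"
        using xy(1,2) by (auto simp: parking_functions_def dyck_paths_def)
      then show "x = y"
        using f by (intro prod_eqI north_columns_inject) (simp_all add: encodes_def)
    qed
    show "(\<lambda>x. THE f. encodes a f x) ` parking_functions a b = parking_maps a b"
    proof (intro equalityI subsetI)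
      fix f assume "f \<in> (\<lambda>x. THE f. encodes a f x) ` parking_functions a b"
      then obtain p w where "(p, w) \<in> parking_functions a b" "f = (THE f. encodes a f (p, w))"
        by auto
      then show "f \<in> parking_maps a b"
        using ex the encodes_parking_functions_iff[OF _ assms] by metis
    next
      fix f assume f: "f \<in> parking_maps a b"
      then have "\<forall>n\<in>set (map fst (graph_list a f)). n \<le> b"
        by (auto simp: parking_maps_def PiE_iff less_imp_le)
      then obtain p where p: "north_columns p = map fst (graph_list a f)" "count_list p East = b"
        using exists_path_with_north_columns[OF sorted_map_fst_graph_list] by blast
      let ?x = "(p, map snd (graph_list a f))"
      have enc: "encodes a f ?x"
        using f p by (auto simp: encodes_def parking_maps_def PiE_iff)
      then have "?x \<in> parking_functions a b"
        using encodes_parking_functions_iff[OF enc assms] f p by simp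
      then show "f \<in> (\<lambda>x. THE f. encodes a f x) ` parking_functions a b"
        using the[OF enc] by (intro image_eqI[of _ _ ?x]) simp_all
    qed
  qed
qed

section \<open>The action of permutations, column by column\<close>

lemma concat_if_eq_filter_zip:
  "length ns = length w \<Longrightarrow>
    concat (map (\<lambda>i. if ns ! i = x then [w ! i] else []) [0..<length w])
    = map snd (filter (\<lambda>z. fst z = x) (zip ns w))"
proof (induction ns w rule: list_induct2)
  case (Cons n ns v w)
  have idx: "[0..<length (v # w)] = 0 # map Suc [0..<length w]"
    by (simp add: upt_conv_Cons map_Suc_upt del: upt_Suc)
  show ?case unfolding idx using Cons by (simp add: comp_def cong: if_cong del: upt_Suc)
qed simp

lemma column_labels_encoded:
  assumes "encodes a f (p, w)"
  shows "column_labels p w x = map snd (filter (\<lambda>z. fst z = x) (graph_list a f))"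
proof -
  have enc: "north_columns p = map fst (graph_list a f)" "w = map snd (graph_list a f)"
    using assms by (simp_all add: encodes_def)
  show ?thesis
    unfolding column_labels_def
    by (subst concat_if_eq_filter_zip) (simp_all add: enc zip_map_fst_snd)
qed

lemma column_labels_props:
  assumes "encodes a f (p, w)"
  shows "sorted (column_labels p w x)" "distinct (column_labels p w x)"
    "set (column_labels p w x) = {l \<in> {1..a}. f l = x}"
proof -
  note cl = column_labels_encoded[OF assms]
  have "sorted_wrt (\<lambda>y z. snd y \<le> snd z) (filter (\<lambda>z. fst z = x) (graph_list a f))"
  proof (rule sorted_wrt_mono_rel)
    show "sorted (filter (\<lambda>z. fst z = x) (graph_list a f))"
      using sorted_graph_list by (rule sorted_wrt_filter)
  qed (auto simp: less_eq_prod_def)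
  then show "sorted (column_labels p w x)" by (simp add: cl sorted_map)
  show "distinct (column_labels p w x)"
    unfolding cl distinct_map using distinct_graph_list by (auto simp: inj_on_def)
  show "set (column_labels p w x) = {l \<in> {1..a}. f l = x}"
    unfolding cl by (auto simp: image_iff)
qed

lemma concat_filter_fst:
  assumes "sorted (map fst zs)" "\<forall>z\<in>set zs. fst z < N"
  shows "concat (map (\<lambda>x. filter (\<lambda>z. fst z = x) zs) [0..<N]) = zs"
proof -
  have split: "filter (\<lambda>z. fst z < Suc n) zs = filter (\<lambda>z. fst z < n) zs @ filter (\<lambda>z. fst z = n) zs" for n
    using assms(1)
  proof (induction zs)
    case (Cons z zs)
    have "filter (\<lambda>z. fst z < n) zs = []" if "fst z = n"
      using Cons.prems that by (force simp: filter_empty_conv)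
    then show ?case using Cons by (auto simp: less_Suc_eq)
  qed simp
  have "concat (map (\<lambda>x. filter (\<lambda>z. fst z = x) zs) [0..<n]) = filter (\<lambda>z. fst z < n) zs" for n
    by (induction n) (simp_all add: split)
  then show ?thesis using assms(2) by (simp add: filter_id_conv)
qed

text \<open>The action keeps the path and the number of labels in each column, so the label lists
  can be compared column by column. Sorted lists of distinct labels agree iff their sets do; hence
  the condition is that \<open>\<sigma>\<close> maps the label set of each column to itself.\<close>

lemma act_parking_fixed_iff:
  assumes \<sigma>: "\<sigma> permutes {1..a}" and "b > 0"
    and enc: "encodes a f (p, w)" and pf: "(p, w) \<in> parking_functions a b"
  shows "act_parking \<sigma> (p, w) = (p, w) \<longleftrightarrow> (\<forall>l\<in>{1..a}. f (\<sigma> l) = f l)"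
proof -
  let ?C = "column_labels p w"
  let ?S = "\<lambda>x. sort (map \<sigma> (?C x))"
  have f: "count_list p East = b" "f \<in> parking_maps a b"
    using encodes_parking_functions_iff[OF enc assms(2)] pf by simp_all
  then have fb: "f l \<le> b" if "l \<in> {1..a}" for l
    using that by (auto simp: parking_maps_def PiE_iff less_imp_le)
  have w: "w = map snd (concat (map (\<lambda>x. filter (\<lambda>z. fst z = x) (graph_list a f)) [0..<Suc b]))"
    using enc fb by (subst concat_filter_fst) (auto simp: encodes_def sorted_map_fst_graph_list less_Suc_eq_le)
  have "concat (map ?C [0..<Suc b])
      = map snd (concat (map (\<lambda>x. filter (\<lambda>z. fst z = x) (graph_list a f)) [0..<Suc b]))"
  proof -
    have "?C = (\<lambda>x. map snd (filter (\<lambda>z. fst z = x) (graph_list a f)))"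
      by (rule ext) (rule column_labels_encoded[OF enc])
    then show ?thesis by (simp add: map_concat comp_def del: upt_Suc)
  qed
  with w have w: "concat (map ?C [0..<Suc b]) = w" by (metis (no_types))
  have "act_parking \<sigma> (p, w) = (p, w) \<longleftrightarrow> concat (map ?S [0..<Suc b]) = concat (map ?C [0..<Suc b])"
    unfolding w using f(1) by (simp add: act_parking_def del: upt_Suc)
  also have "\<dots> \<longleftrightarrow> map ?S [0..<Suc b] = map ?C [0..<Suc b]"
    by (rule concat_eq_concat_iff) (auto simp: zip_map1 zip_map2 zip_same_conv_map simp del: upt_Suc)
  also have "\<dots> \<longleftrightarrow> (\<forall>x\<le>b. ?S x = ?C x)"
    by (auto simp del: upt_Suc simp: less_Suc_eq_le)
  also have "\<dots> \<longleftrightarrow> (\<forall>l\<in>{1..a}. f (\<sigma> l) = f l)"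
  proof
    assume *: "\<forall>x\<le>b. ?S x = ?C x"
    show "\<forall>l\<in>{1..a}. f (\<sigma> l) = f l"
    proof
      fix l assume l: "l \<in> {1..a}"
      then have "?S (f l) = ?C (f l)" using * fb by blast
      then have "\<sigma> ` set (?C (f l)) = set (?C (f l))" by (metis set_map set_sort)
      moreover have "l \<in> set (?C (f l))" using l column_labels_props(3)[OF enc] by simp
      ultimately have "\<sigma> l \<in> set (?C (f l))" by blast
      then show "f (\<sigma> l) = f l" using column_labels_props(3)[OF enc] by simp
    qed
  next
    assume *: "\<forall>l\<in>{1..a}. f (\<sigma> l) = f l"
    show "\<forall>x\<le>b. ?S x = ?C x"
    proof (intro allI impI)
      fix x
      have "\<sigma> ` {l \<in> {1..a}. f l = x} \<subseteq> {l \<in> {1..a}. f l = x}"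
        using * permutes_in_image[OF \<sigma>] by auto
      then have "\<sigma> ` {l \<in> {1..a}. f l = x} = {l \<in> {1..a}. f l = x}"
        using permutes_inj_on[OF \<sigma>] by (intro endo_inj_surj) auto
      then have "set (?S x) = set (?C x)"
        by (simp add: column_labels_props(3)[OF enc])
      moreover have "distinct (?S x)"
        using column_labels_props(2)[OF enc] permutes_inj_on[OF \<sigma>] by (simp add: distinct_map)
      ultimately show "?S x = ?C x"
        using column_labels_props(1,2)[OF enc] by (intro sorted_distinct_set_unique) auto
    qed
  qed
  finally show ?thesis .
qed

lemma image_Collect_compose: "f ` {x \<in> A. P (f x)} = {y \<in> f ` A. P y}"
  by blast

lemma perm_character_parking_functions:
  assumes \<sigma>: "\<sigma> permutes {1..a}" and "a > 0" "b > 0" "coprime a b"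
  shows "perm_character (parking_functions a b) act_parking \<sigma> = of_nat b ^ (size (cycle_type a \<sigma>) - 1)"
proof -
  let ?X = "parking_functions a b"
  let ?e = "\<lambda>x. THE f. encodes a f x"
  let ?Y = "{f \<in> parking_maps a b. \<forall>l\<in>{1..a}. f (\<sigma> l) = f l}"
  note bij = bij_betw_parking_functions[OF assms(3), of a]
  have "finite (parking_maps a b)"
    by (rule finite_subset[of _ "{1..a} \<rightarrow>\<^sub>E {..<b}"]) (auto simp: parking_maps_def intro: finite_PiE)
  then have fin: "finite ?X" using bij_betw_finite[OF bij] by simp
  have enc: "encodes a (?e x) x" if x: "x \<in> ?X" for x
  proof -
    obtain f where f: "encodes a f x"
      using x parking_function_encoded by (cases x) metis
    then have "?e x = f" using encodes_unique by blast
    with f show ?thesis by simp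
  qed
  have "act_parking \<sigma> x = x \<longleftrightarrow> (\<forall>l\<in>{1..a}. ?e x (\<sigma> l) = ?e x l)" if "x \<in> ?X" for x
    using act_parking_fixed_iff[OF \<sigma> assms(3), of "?e x" "fst x" "snd x"] enc[OF that] that by simp
  then have "{x \<in> ?X. act_parking \<sigma> x = x} = {x \<in> ?X. \<forall>l\<in>{1..a}. ?e x (\<sigma> l) = ?e x l}"
    by (intro Collect_cong conj_cong refl)
  moreover have "?e ` {x \<in> ?X. \<forall>l\<in>{1..a}. ?e x (\<sigma> l) = ?e x l} = {f \<in> ?e ` ?X. \<forall>l\<in>{1..a}. f (\<sigma> l) = f l}"
    by (rule image_Collect_compose)
  moreover have "?e ` ?X = parking_maps a b"
    using bij by (simp add: bij_betw_def)
  ultimately have "?e ` {x \<in> ?X. act_parking \<sigma> x = x} = ?Y"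
    by simp
  moreover have "inj_on ?e {x \<in> ?X. act_parking \<sigma> x = x}"
    using bij by (auto simp: bij_betw_def intro: inj_on_subset)
  ultimately have card: "card {x \<in> ?X. act_parking \<sigma> x = x} = card ?Y"
    using card_image[of ?e "{x \<in> ?X. act_parking \<sigma> x = x}"] by simp
  \<comment> \<open>As \<open>a > 0\<close> there is at least one cycle, so the exponent
    \<open>size (cycle_type a \<sigma>) - 1\<close> is not truncated and one factor \<open>b\<close>
    can be cancelled.\<close>
  have "size (cycle_type a \<sigma>) > 0"
    using assms(2) by (simp add: size_cycle_type card_gt_0_iff)
  then obtain k where "size (cycle_type a \<sigma>) = Suc k" by (metis gr0_implies_Suc)
  then have "b * card ?Y = b * b ^ (size (cycle_type a \<sigma>) - 1)"
    using card_parking_maps_invariant[OF \<sigma> assms(3,4)] by simp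
  then show ?thesis
    using assms(3) by (simp add: perm_character_eq_card_fixed[OF fin] card)
qed

section \<open>The Frobenius characteristic\<close>

theorem theorem3:
  fixes a b :: nat
  assumes "a > 0" and "b > 0" and "coprime a b"
  shows "Frob a (perm_character (parking_functions a b) act_parking)
      = (\<Sum>\<mu>\<in>partitions a.
          scale (1 / of_nat b * of_nat (multinomial b
              ((int b - int (size \<mu>)) # map (\<lambda>j. int (count \<mu> j)) [1..<Suc a])))
            (h_fun \<mu>))
    \<and> Frob a (perm_character (parking_functions a b) act_parking)
      = (\<Sum>\<mu>\<in>partitions a. scale (of_nat b ^ (size \<mu> - 1) / of_nat (zee \<mu>)) (p_fun \<mu>))
    \<and> Frob a (perm_character (parking_functions a b) act_parking)
      = (\<Sum>\<mu>\<in>partitions a. scale (evaluate_ones b (s_fun \<mu>) / of_nat b) (s_fun \<mu>))"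
proof -
  let ?F = "Frob a (perm_character (parking_functions a b) act_parking)"
  have "class_value a (perm_character (parking_functions a b) act_parking) \<mu> = of_nat b ^ (size \<mu> - 1)"
    if "\<mu> \<in> partitions a" for \<mu>
    using class_value_eq[OF that, where c = "\<lambda>\<mu>. of_nat b ^ (size \<mu> - 1)"]
      perm_character_parking_functions assms by blast
  then have p: "?F = (\<Sum>\<mu>\<in>partitions a. scale (of_nat b ^ (size \<mu> - 1) / of_nat (zee \<mu>)) (p_fun \<mu>))"
    by (simp add: Frob_def)
  also have "\<dots> = (\<Sum>\<mu>\<in>partitions a. scale (1 / of_nat b) (scale (of_nat b ^ size \<mu> / of_nat (zee \<mu>)) (p_fun \<mu>)))"
  proof (rule sum.cong[OF refl])
    fix \<mu> assume "\<mu> \<in> partitions a"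
    \<comment> \<open>\<open>a > 0\<close> excludes the empty partition, so
      \<open>b ^ (size \<mu> - 1)\<close> is \<open>b ^ size \<mu>\<close> divided by
      \<open>b\<close>.\<close>
    then have "\<mu> \<noteq> {#}" using assms(1) by (auto simp: partitions_def)
    then obtain k where "size \<mu> = Suc k" by (metis gr0_implies_Suc nonempty_has_size)
    then show "scale (of_nat b ^ (size \<mu> - 1) / of_nat (zee \<mu>)) (p_fun \<mu>)
        = scale (1 / of_nat b) (scale (of_nat b ^ size \<mu> / of_nat (zee \<mu>)) (p_fun \<mu>))"
      using assms(2) by simp
  qed
  also have "\<dots> = scale (1 / of_nat b) (h_copies b a)"
    by (simp only: scale_sum[symmetric] p_expansion_h_copies)
  finally have F: "?F = scale (1 / of_nat b) (h_copies b a)" .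
  have "(\<Sum>\<mu>\<in>partitions a.
          scale (1 / of_nat b * of_nat (multinomial b
              ((int b - int (size \<mu>)) # map (\<lambda>j. int (count \<mu> j)) [1..<Suc a])))
            (h_fun \<mu>))
      = (\<Sum>\<mu>\<in>partitions a. scale (1 / of_nat b) (scale (multinomial_coeff b \<mu>) (h_fun \<mu>)))"
    unfolding scale_scale by (intro sum.cong refl) (simp only: multinomial_eq_multinomial_coeff)
  also have "\<dots> = ?F"
    by (simp only: scale_sum[symmetric] h_expansion_h_copies F)
  finally have h: "?F = (\<Sum>\<mu>\<in>partitions a.
          scale (1 / of_nat b * of_nat (multinomial b
              ((int b - int (size \<mu>)) # map (\<lambda>j. int (count \<mu> j)) [1..<Suc a])))
            (h_fun \<mu>))" ..
  have "(\<Sum>\<mu>\<in>partitions a. scale (evaluate_ones b (s_fun \<mu>) / of_nat b) (s_fun \<mu>))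
      = (\<Sum>\<mu>\<in>partitions a. scale (1 / of_nat b) (scale (evaluate_ones b (s_fun \<mu>)) (s_fun \<mu>)))"
    by simp
  also have "\<dots> = ?F"
    by (simp only: scale_sum[symmetric] s_expansion_h_copies F)
  finally have s: "?F = (\<Sum>\<mu>\<in>partitions a. scale (evaluate_ones b (s_fun \<mu>) / of_nat b) (s_fun \<mu>))" ..
  show ?thesis using h p s by blast
qed

end
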